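(* Suppose the prior $\Pi$ has the Kullback–Leibler property, i.e. $\Pi(\{f : D(f,f_0)<\varepsilon\})>0$ for every $\varepsilon>0$, and that, with $I_n=\int R_n(f)\,\Pi(df)$, $$\sum_{n\ge 1} n^{-2}\operatorname{Var}\{\log(I_n/I_{n-1})\}<\infty .$$ Then $$\frac1N\sum_{n=1}^N D(f_{n-1},f_0)\to 0\qquad\text{a.s. } [F_0^\infty]\text{ as } N\to\infty,$$ where $f_n$ is the predictive density.
   Context: Let $X_1,X_2,\ldots$, taking values in $(\mathscr{X},\mathscr{B})$, be i.i.d. with fixed density $f_0$ (with respect to Lebesgue measure) and distribution $F_0$; $F_0^\infty$ is the infinite product measure, and all almost sure statements and variances refer to it. $\Omega$ is the space of density functions (with respect to Lebesgue measure) on $(\mathscr{X},\mathscr{B})$, and the prior $\Pi$ is a probability distribution on $\Omega$. Put $R_n(f)=\prod_{i=1}^n f(X_i)/f_0(X_i)$ (with $R_0\equiv 1$, so $I_0=1$). The posterior is $\Pi^n(A)=\int_A R_n(f)\,\Pi(df)/\int R_n(f)\,\Pi(df)$, and the predictive density is $f_n(x)=\int f(x)\,\Pi^n(df)$, $n\ge 0$ (with $\Pi^0=\Pi$). The Kullback–Leibler divergence is $D(f,f_0)=\int f_0\log(f_0/f)$. *)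

theory Defs
  imports "HOL-Probability.Probability"
begin

(* Lebesgue measure on the Borel sets of the sample space X. *)
definition base_measure :: "'a::euclidean_space set \<Rightarrow> 'a measure" where
  "base_measure X = restrict_space lborel X"

(* Values outside X are irrelevant. *)
definition densities :: "'a::euclidean_space set \<Rightarrow> ('a \<Rightarrow> real) set" where
  "densities X = {f. f \<in> borel_measurable (base_measure X) \<and> (\<forall>x\<in>X. 0 \<le> f x) \<and>
     (\<integral>\<^sup>+x. ennreal (f x) \<partial>base_measure X) = 1}"

(* The joint measurability of (f, x) \<mapsto> f x is what gives the integrals over f below (posterior
   and predictive density) their meaning.  No sigma-algebra on the set of all densities has this
   property (Aumann 1961: the sections of a product-measurable set have bounded Borel rank), hence
   the carrier of a prior is a subset of it. *)
definition is_prior :: "'a::euclidean_space set \<Rightarrow> ('a \<Rightarrow> real) measure \<Rightarrow> bool" where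
  "is_prior X prior \<longleftrightarrow> prob_space prior \<and> space prior \<subseteq> densities X \<and>
     (\<lambda>(f, x). f x) \<in> borel_measurable (prior \<Otimes>\<^sub>M base_measure X)"

(* f0 log (f0 / f) with 0 log (0 / y) = 0, and value \<infinity> where f vanishes but f0 does not. *)
definition KL_integrand :: "('a \<Rightarrow> real) \<Rightarrow> ('a \<Rightarrow> real) \<Rightarrow> 'a \<Rightarrow> ereal" where
  "KL_integrand f f0 x =
     (if f0 x = 0 then 0 else if f x = 0 then \<infinity> else ereal (f0 x * ln (f0 x / f x)))"

(* Positive part minus negative part, so that an infinite divergence is really \<infinity>; the real-valued
   KL_divergence of HOL-Probability is 0 in that case.  For densities the negative part is finite,
   since f0 log (f0 / f) \<ge> f0 - f. *)
definition KL :: "'a::euclidean_space set \<Rightarrow> ('a \<Rightarrow> real) \<Rightarrow> ('a \<Rightarrow> real) \<Rightarrow> ereal" where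
  "KL X f f0 =
     enn2ereal (\<integral>\<^sup>+x. e2ennreal (KL_integrand f f0 x) \<partial>base_measure X) -
     enn2ereal (\<integral>\<^sup>+x. e2ennreal (- KL_integrand f f0 x) \<partial>base_measure X)"

definition KL_property :: "'a::euclidean_space set \<Rightarrow> ('a \<Rightarrow> real) \<Rightarrow> ('a \<Rightarrow> real) measure \<Rightarrow> bool" where
  "KL_property X f0 prior \<longleftrightarrow> (\<forall>\<epsilon>::real. \<epsilon> > 0 \<longrightarrow> measure prior {f \<in> space prior. KL X f f0 < ereal \<epsilon>} > 0)"

(* The law of the data; the coordinate \<omega> i of a sample path \<omega> is the observation with
   number i + 1. *)
definition data_law :: "'a::euclidean_space set \<Rightarrow> ('a \<Rightarrow> real) \<Rightarrow> (nat \<Rightarrow> 'a) measure" where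
  "data_law X f0 = (\<Pi>\<^sub>M i\<in>(UNIV::nat set). density (base_measure X) (\<lambda>x. ennreal (f0 x)))"

definition likelihood_ratio :: "('a \<Rightarrow> real) \<Rightarrow> (nat \<Rightarrow> 'a) \<Rightarrow> nat \<Rightarrow> ('a \<Rightarrow> real) \<Rightarrow> real" where
  "likelihood_ratio f0 \<omega> n f = (\<Prod>i<n. f (\<omega> i) / f0 (\<omega> i))"

(* Under the Kullback-Leibler property, 0 < evidence < \<infinity> for almost all \<omega>, and the predictive density
   below is finite for almost all \<omega> and x; the value 0 of the Bochner integral of a
   non-integrable function thus only occurs on null sets. *)
definition evidence :: "('a \<Rightarrow> real) measure \<Rightarrow> ('a \<Rightarrow> real) \<Rightarrow> (nat \<Rightarrow> 'a) \<Rightarrow> nat \<Rightarrow> real" where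
  "evidence prior f0 \<omega> n = (\<integral>f. likelihood_ratio f0 \<omega> n f \<partial>prior)"

definition posterior ::
  "('a \<Rightarrow> real) measure \<Rightarrow> ('a \<Rightarrow> real) \<Rightarrow> (nat \<Rightarrow> 'a) \<Rightarrow> nat \<Rightarrow> ('a \<Rightarrow> real) measure" where
  "posterior prior f0 \<omega> n = density prior (\<lambda>f. ennreal (likelihood_ratio f0 \<omega> n f / evidence prior f0 \<omega> n))"

definition predictive ::
  "('a \<Rightarrow> real) measure \<Rightarrow> ('a \<Rightarrow> real) \<Rightarrow> (nat \<Rightarrow> 'a) \<Rightarrow> nat \<Rightarrow> 'a \<Rightarrow> real" where
  "predictive prior f0 \<omega> n x = (\<integral>f. f x \<partial>posterior prior f0 \<omega> n)"

(* Unlike prob_space.variance, this is \<infinity>, not 0, if Y is not square integrable. *)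
definition ext_variance :: "'b measure \<Rightarrow> ('b \<Rightarrow> real) \<Rightarrow> ennreal" where
  "ext_variance M Y =
     (if integrable M Y then \<integral>\<^sup>+\<omega>. ennreal ((Y \<omega> - (\<integral>\<omega>'. Y \<omega>' \<partial>M))\<^sup>2) \<partial>M else \<infinity>)"

end

theory Submission
  imports Defs
begin

text \<open>Write \<open>I\<^sub>n\<close> for the evidence and \<open>L\<^sub>n = ln (I\<^sub>n\<^sub>+\<^sub>1 / I\<^sub>n)\<close>. A new observation multiplies the evidence by the
  ratio of the predictive density to the true density at that observation. Hence the conditional
  expectation of \<open>L\<^sub>n\<close> given the first \<open>n\<close> observations is minus the divergence \<open>D\<^sub>n\<close> of the
  predictive density (\<open>KL_predictive\<close>), and \<open>L\<^sub>n + D\<^sub>n\<close> is a sequence of martingale differences whose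
  second moments are at most the variances of the \<open>L\<^sub>n\<close>. The assumption on the variances is thus
  what the strong law for martingales needs (\<open>adapted_strong_law\<close>), and since the \<open>L\<^sub>n\<close> telescope,
  \<open>(ln I\<^sub>N + D\<^sub>0 + \<dots> + D\<^sub>N\<^sub>-\<^sub>1) / N\<close> tends to \<open>0\<close> almost surely.

  As \<open>D\<^sub>n \<ge> 0\<close>, it remains to bound the evidence from below: the lower limit of \<open>ln I\<^sub>N / N\<close> must not be
  negative. Write \<open>R\<^sub>N\<close> for the likelihood ratio, so that \<open>I\<^sub>N\<close> is its prior mean. Let \<open>Q\<close> be the
  prior conditioned on the set of densities with divergence less than \<open>\<epsilon>\<close>, and \<open>a > 0\<close> the mass of this set. By Jensen's inequality, \<open>ln I\<^sub>N \<ge> ln a + \<integral> ln R\<^sub>N \<partial>Q\<close>, and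
  the integral is a sum over the observations of one function \<open>g\<close> whose mean is at least \<open>-\<epsilon>\<close>
  (\<open>evidence_lower_bound\<close>). The law of large numbers for \<open>g\<close> gives the bound. Averaging \<open>ln R\<^sub>N\<close> over
  \<open>Q\<close> first means that this law is applied to one function, not to each density separately.

  Both laws of large numbers come from one source. A martingale stopped when its absolute value first
  reaches a level is again a martingale, which yields the maximal inequality; dyadic blocks and the
  Borel-Cantelli lemma turn it into \<open>martingale_strong_law\<close>. The law for independent observations
  follows by truncation. Conditioning on the first \<open>n\<close> observations is concrete: it keeps these
  observations and integrates over a fresh copy of the remaining ones (\<open>cond_exp_history\<close>).\<close>

section \<open>Elementary estimates\<close>

lemma square_integrable_product:
  fixes f g :: "'a \<Rightarrow> real"
  assumes [measurable]: "f \<in> borel_measurable M" "g \<in> borel_measurable M"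
    and "integrable M (\<lambda>\<omega>. (f \<omega>)\<^sup>2)" "integrable M (\<lambda>\<omega>. (g \<omega>)\<^sup>2)"
  shows "integrable M (\<lambda>\<omega>. f \<omega> * g \<omega>)"
proof (rule Bochner_Integration.integrable_bound)
  show "integrable M (\<lambda>\<omega>. (f \<omega>)\<^sup>2 + (g \<omega>)\<^sup>2)" using assms by simp
  show "AE \<omega> in M. norm (f \<omega> * g \<omega>) \<le> norm ((f \<omega>)\<^sup>2 + (g \<omega>)\<^sup>2)"
  proof (rule AE_I2)
    fix \<omega>
    have "0 \<le> (\<bar>f \<omega>\<bar> - \<bar>g \<omega>\<bar>)\<^sup>2" "0 \<le> \<bar>f \<omega>\<bar> * \<bar>g \<omega>\<bar>" by simp_all
    then have "\<bar>f \<omega>\<bar> * \<bar>g \<omega>\<bar> \<le> (f \<omega>)\<^sup>2 + (g \<omega>)\<^sup>2"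
      unfolding power2_diff power2_abs by linarith
    then show "norm (f \<omega> * g \<omega>) \<le> norm ((f \<omega>)\<^sup>2 + (g \<omega>)\<^sup>2)"
      by (simp add: abs_mult)
  qed
qed simp

lemma geometric_tail:
  "(\<Sum>k<K. if T \<le> k then 1 / 4 ^ k else (0::real)) = (if T \<le> K then 4/3 * (1 / 4 ^ T - 1 / 4 ^ K) else 0)"
proof (induction K)
  case (Suc K)
  then show ?case by (cases "T = Suc K") (auto simp: field_simps)
qed simp

text \<open>Swap the two sums: the index \<open>j\<close> occurs in the blocks with \<open>2\<^sup>k\<^sup>+\<^sup>1 > j\<close>, whose weights \<open>4\<^sup>-\<^sup>k\<close> form
  a geometric tail of order \<open>j\<^sup>-\<^sup>2\<close>.\<close>

lemma dyadic_block_summable: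
  fixes a :: "nat \<Rightarrow> real"
  assumes nonneg: "\<And>j. 0 \<le> a j" and sum: "summable (\<lambda>j. a j / (real (Suc j))\<^sup>2)"
  shows "summable (\<lambda>k. (\<Sum>j<2 ^ Suc k. a j) / 4 ^ k)"
proof -
  have weight: "(\<Sum>k<K. if j < 2 ^ Suc k then 1 / 4 ^ k else (0::real)) \<le> 6 / (real (Suc j))\<^sup>2" for j K
  proof -
    \<comment> \<open>the first block that contains \<open>j\<close>\<close>
    define T where "T = (LEAST k. j < (2::nat) ^ Suc k)"
    have "j < 2 ^ Suc j"
      by (meson less_exp less_trans lessI)
    then have T: "j < 2 ^ Suc T"
      unfolding T_def by (rule LeastI)
    have iff: "j < 2 ^ Suc k \<longleftrightarrow> T \<le> k" for k
    proof
      show "j < 2 ^ Suc k \<Longrightarrow> T \<le> k" unfolding T_def by (rule Least_le)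
      assume "T \<le> k"
      then have "(2::nat) ^ Suc T \<le> 2 ^ Suc k" by (intro power_increasing) auto
      with T show "j < 2 ^ Suc k" by (rule less_le_trans)
    qed
    have "real (Suc j) \<le> real (2 ^ Suc T)" using T by (intro of_nat_mono) simp
    then have "(real (Suc j))\<^sup>2 \<le> (real (2 ^ Suc T))\<^sup>2" by (rule power_mono) simp
    also have "(real (2 ^ Suc T))\<^sup>2 = 4 * 4 ^ T"
      by (simp add: power2_eq_square power_mult_distrib[symmetric])
    finally have "(real (Suc j))\<^sup>2 \<le> 4 * 4 ^ T" .
    then have tail: "1 / 4 ^ T \<le> 4 / (real (Suc j))\<^sup>2"
      by (simp add: field_simps del: of_nat_Suc)
    have "(\<Sum>k<K. if j < 2 ^ Suc k then 1 / 4 ^ k else (0::real)) \<le> 4/3 * (1 / 4 ^ T)"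
      unfolding iff geometric_tail by simp
    also have "\<dots> \<le> 4/3 * (4 / (real (Suc j))\<^sup>2)"
      by (rule mult_left_mono[OF tail]) simp
    also have "\<dots> = 16/3 / (real (Suc j))\<^sup>2" by simp
    also have "\<dots> \<le> 6 / (real (Suc j))\<^sup>2"
      by (intro divide_right_mono) simp_all
    finally show ?thesis .
  qed
  show ?thesis
  proof (rule summableI_nonneg_bounded)
    fix K
    have "(\<Sum>k<K. (\<Sum>j<2 ^ Suc k. a j) / 4 ^ k)
        = (\<Sum>k<K. \<Sum>j<2 ^ K. a j * (if j < 2 ^ Suc k then 1 / 4 ^ k else 0))"
    proof (rule sum.cong)
      fix k assume "k \<in> {..<K}"
      then have "(2::nat) ^ Suc k \<le> 2 ^ K" by (intro power_increasing) auto
      then have "{..<2 ^ Suc k} = {..<2 ^ K} \<inter> {j. j < (2::nat) ^ Suc k}" by auto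
      then show "(\<Sum>j<2 ^ Suc k. a j) / 4 ^ k = (\<Sum>j<2 ^ K. a j * (if j < 2 ^ Suc k then 1 / 4 ^ k else 0))"
        by (simp add: sum.If_cases sum_divide_distrib if_distrib del: power_Suc cong: if_cong)
    qed simp
    also have "\<dots> = (\<Sum>j<2 ^ K. a j * (\<Sum>k<K. if j < 2 ^ Suc k then 1 / 4 ^ k else 0))"
      by (subst sum.swap) (simp add: sum_distrib_left)
    also have "\<dots> \<le> (\<Sum>j<2 ^ K. a j * (6 / (real (Suc j))\<^sup>2))"
      by (intro sum_mono mult_left_mono weight nonneg)
    also have "\<dots> = 6 * (\<Sum>j<2 ^ K. a j / (real (Suc j))\<^sup>2)"
      by (simp add: sum_distrib_left mult_ac)
    also have "\<dots> \<le> 6 * (\<Sum>j. a j / (real (Suc j))\<^sup>2)"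
      by (intro mult_left_mono sum_le_suminf sum) (auto simp: nonneg)
    finally show "(\<Sum>k<K. (\<Sum>j<2 ^ Suc k. a j) / 4 ^ k) \<le> 6 * (\<Sum>j. a j / (real (Suc j))\<^sup>2)" .
  qed (simp add: sum_nonneg nonneg)
qed

lemma Cesaro_mean:
  fixes u :: "nat \<Rightarrow> real"
  assumes "u \<longlonglongrightarrow> l"
  shows "(\<lambda>N. (\<Sum>n<N. u n) / real N) \<longlonglongrightarrow> l"
proof (rule LIMSEQ_I)
  fix e :: real assume "e > 0"
  then obtain N0 where N0: "\<And>n. n \<ge> N0 \<Longrightarrow> \<bar>u n - l\<bar> < e / 2"
    using LIMSEQ_D[OF assms, of "e / 2"] by auto
  define C where "C = (\<Sum>n<N0. \<bar>u n - l\<bar>)"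
  obtain N1 where N1: "real N1 > 2 * C / e" using reals_Archimedean2 by blast
  show "\<exists>no. \<forall>N\<ge>no. norm ((\<Sum>n<N. u n) / real N - l) < e"
  proof (intro exI[of _ "max (Suc N0) N1"] allI impI)
    fix N assume "max (Suc N0) N1 \<le> N"
    then have N: "N0 \<le> N" "N1 \<le> N" "N > 0" by auto
    have "2 * C / e < real N" using N1 N(2) by linarith
    then have C: "C < real N * (e / 2)" using \<open>e > 0\<close> by (simp add: field_simps)
    have "\<bar>\<Sum>n<N. u n - l\<bar> \<le> (\<Sum>n<N. \<bar>u n - l\<bar>)" by (rule sum_abs)
    also have "\<dots> = C + (\<Sum>n\<in>{N0..<N}. \<bar>u n - l\<bar>)"
      unfolding C_def using N(1) by (simp add: lessThan_atLeast0 sum.atLeastLessThan_concat)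
    also have "(\<Sum>n\<in>{N0..<N}. \<bar>u n - l\<bar>) \<le> (\<Sum>n\<in>{N0..<N}. e / 2)"
      proof (rule sum_mono)
      show "\<bar>u n - l\<bar> \<le> e / 2" if "n \<in> {N0..<N}" for n
        using N0[of n] that by (intro less_imp_le) simp
    qed
    also have "\<dots> \<le> real N * (e / 2)" using \<open>e > 0\<close> by (simp add: mult_right_mono)
    finally have "\<bar>\<Sum>n<N. u n - l\<bar> < real N * e" using C by linarith
    moreover have "(\<Sum>n<N. u n) / real N - l = (\<Sum>n<N. u n - l) / real N"
      using \<open>N > 0\<close> by (simp add: sum_subtractf field_simps)
    ultimately show "norm ((\<Sum>n<N. u n) / real N - l) < e"
      using \<open>N > 0\<close> by (simp add: field_simps)
  qed
qed

text \<open>Compare \<open>1 / (n + 1)\<^sup>2\<close> with \<open>1 / n - 1 / (n + 1)\<close> and telescope. The right-hand side keeps the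
  remainder \<open>1 / K\<close> so that the claim is inductive; the bound in use is \<open>2 / a\<close>.\<close>

lemma sum_inverse_squares_from:
  fixes a :: real
  assumes "a > 0"
  shows "(\<Sum>n<K. if a \<le> real (Suc n) then 1 / (real (Suc n))\<^sup>2 else 0) \<le> (if a \<le> real K then 2 / a - 1 / real K else 0)"
proof (induction K)
  case 0
  then show ?case using assms by simp
next
  case (Suc K)
  define k where "k = real K"
  have "k \<ge> 0" by (simp add: k_def)
  have S: "real (Suc K) = k + 1" by (simp add: k_def)
  consider "a \<le> k" | "k < a" "a \<le> k + 1" | "k + 1 < a" by linarith
  then show ?case
  proof cases
    case 1
    with assms have "k > 0" by linarith
    then have "1 / (k + 1)\<^sup>2 \<le> 1 / k - 1 / (k + 1)"
      by (simp add: divide_simps power2_eq_square)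
    with Suc.IH 1 show ?thesis by (simp add: S k_def[symmetric] add.commute)
  next
    case 2
    have "1 / (k + 1) \<le> 1 / a" using 2 assms by (simp add: frac_le)
    moreover have "1 / (k + 1)\<^sup>2 \<le> 1 / (k + 1)"
      using \<open>k \<ge> 0\<close> by (simp add: divide_simps power2_eq_square)
    ultimately show ?thesis using Suc.IH 2 by (simp add: S k_def[symmetric] add.commute)
  next
    case 3
    with Suc.IH show ?thesis by (simp add: S k_def[symmetric] add.commute)
  qed
qed

text \<open>With \<open>a = \<bar>g x\<bar>\<close>, this bounds the sum over \<open>n\<close> of the probabilities that \<open>\<bar>g\<bar>\<close> exceeds \<open>n + 1\<close> by
  the mean of \<open>\<bar>g\<bar>\<close>.\<close>

lemma count_below:
  fixes a :: real
  assumes "a \<ge> 0"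
  shows "(\<Sum>n<K. if real (Suc n) < a then 1 else (0::real)) \<le> min a (real K)"
proof (induction K)
  case (Suc K)
  then show ?case by (cases "real (Suc K) < a") (auto simp: min_def split: if_splits)
qed (use assms in simp)

section \<open>A strong law for adapted sequences\<close>

locale filtered_prob_space = prob_space M for M :: "'a measure" +
  fixes F :: "nat \<Rightarrow> 'a measure"
  assumes subalgebra_F: "subalgebra M (F n)"
    and subalgebra_F_Suc: "subalgebra (F (Suc n)) (F n)"
begin

lemma sigma_finite_subalgebra_F: "sigma_finite_subalgebra M (F n)"
  by (rule finite_measure_subalgebra_is_sigma_finite)
     (simp add: finite_measure_subalgebra_def finite_measure_subalgebra_axioms_def
        subalgebra_F finite_measure_axioms)

lemma measurable_F_mono:
  assumes "f \<in> measurable (F m) N" "m \<le> n"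
  shows "f \<in> measurable (F n) N"
  using assms(2) by (induction rule: dec_induct)
    (use assms(1) measurable_from_subalg[OF subalgebra_F_Suc] in auto)

lemma measurable_F_M: "f \<in> measurable (F n) N \<Longrightarrow> f \<in> measurable M N"
  by (rule measurable_from_subalg[OF subalgebra_F])

text \<open>The increment with index \<open>n\<close> becomes known at time \<open>n + 1\<close>.\<close>

definition martingale_differences :: "(nat \<Rightarrow> 'a \<Rightarrow> real) \<Rightarrow> bool" where
  "martingale_differences d \<longleftrightarrow> (\<forall>n. d n \<in> borel_measurable (F (Suc n)) \<and>
     integrable M (\<lambda>\<omega>. (d n \<omega>)\<^sup>2) \<and> (AE \<omega> in M. real_cond_exp M (F n) (d n) \<omega> = 0))"

lemma partial_sum_measurable:
  assumes "martingale_differences d"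
  shows "(\<lambda>\<omega>. \<Sum>i<N. d i \<omega>) \<in> borel_measurable (F N)"
  using assms unfolding martingale_differences_def
  by (intro borel_measurable_sum measurable_F_mono[of _ "Suc _" _ N]) auto

text \<open>An increment is orthogonal to every square integrable function of its past, in particular to the
  preceding partial sum.\<close>

lemma martingale_square_integral:
  assumes "martingale_differences d"
  shows "integrable M (\<lambda>\<omega>. (\<Sum>i<N. d i \<omega>)\<^sup>2)
    \<and> expectation (\<lambda>\<omega>. (\<Sum>i<N. d i \<omega>)\<^sup>2) = (\<Sum>i<N. expectation (\<lambda>\<omega>. (d i \<omega>)\<^sup>2))"
proof (induction N)
  case (Suc N)
  define S where "S = (\<lambda>\<omega>. \<Sum>i<N. d i \<omega>)"
  have SF: "S \<in> borel_measurable (F N)"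
    using partial_sum_measurable[OF assms] by (simp add: S_def)
  have d: "d N \<in> borel_measurable M" "integrable M (\<lambda>\<omega>. (d N \<omega>)\<^sup>2)"
      "AE \<omega> in M. real_cond_exp M (F N) (d N) \<omega> = 0"
    using assms measurable_F_M unfolding martingale_differences_def by blast+
  have S: "S \<in> borel_measurable M" "integrable M (\<lambda>\<omega>. (S \<omega>)\<^sup>2)"
    using SF measurable_F_M Suc.IH unfolding S_def by blast+
  have int: "integrable M (\<lambda>\<omega>. S \<omega> * d N \<omega>)"
    using square_integrable_product[OF S(1) d(1) S(2) d(2)] .
  have "expectation (\<lambda>\<omega>. S \<omega> * d N \<omega>) = expectation (\<lambda>\<omega>. S \<omega> * real_cond_exp M (F N) (d N) \<omega>)"
    using sigma_finite_subalgebra.real_cond_exp_intg(2)[OF sigma_finite_subalgebra_F int SF d(1)] by simp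
  also have "\<dots> = expectation (\<lambda>\<omega>. 0)"
    by (rule integral_cong_AE) (use d S in auto)
  finally have orth: "expectation (\<lambda>\<omega>. S \<omega> * d N \<omega>) = 0" by simp
  have eq: "(\<Sum>i<Suc N. d i \<omega>)\<^sup>2 = (S \<omega>)\<^sup>2 + (d N \<omega>)\<^sup>2 + 2 * (S \<omega> * d N \<omega>)" for \<omega>
    by (simp add: S_def power2_sum)
  show ?case
    unfolding eq using S(2) d(2) int orth Suc.IH by (simp add: S_def)
qed simp

text \<open>Kolmogorov's inequality. Multiplying the increments by the indicator \<open>h\<close> that no partial sum has
  reached \<open>c\<close> so far gives martingale differences again, and their sum freezes at the first partial
  sum that reaches \<open>c\<close>. So the event about the maximum is an event about one square integrable
  variable, to which Markov's inequality applies.\<close>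

lemma martingale_maximal_inequality:
  assumes d: "martingale_differences d" and "c > 0"
  shows "prob {\<omega>\<in>space M. \<exists>n\<le>N. c \<le> \<bar>\<Sum>i<n. d i \<omega>\<bar>} \<le> (\<Sum>i<N. expectation (\<lambda>\<omega>. (d i \<omega>)\<^sup>2)) / c\<^sup>2"
proof -
  define S where "S = (\<lambda>n \<omega>. \<Sum>i<n. d i \<omega>)"
  define h where "h = (\<lambda>n \<omega>. \<Prod>m\<le>n. if \<bar>S m \<omega>\<bar> < c then 1 else (0::real))"
  define e where "e = (\<lambda>n \<omega>. h n \<omega> * d n \<omega>)"
  have SF: "S m \<in> borel_measurable (F n)" if "m \<le> n" for m n
    unfolding S_def using partial_sum_measurable[OF d] that by (rule measurable_F_mono)
  have h01: "h n \<omega> = (if \<forall>m\<le>n. \<bar>S m \<omega>\<bar> < c then 1 else 0)" for n \<omega>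
    by (auto simp: h_def intro!: prod.neutral)
  have hF: "h n \<in> borel_measurable (F n)" for n
    unfolding h_def
  proof (intro borel_measurable_prod)
    fix m assume "m \<in> {..n}"
    then have [measurable]: "S m \<in> borel_measurable (F n)" by (simp add: SF)
    show "(\<lambda>\<omega>. if \<bar>S m \<omega>\<bar> < c then 1 else (0::real)) \<in> borel_measurable (F n)" by measurable
  qed
  have dF: "d n \<in> borel_measurable (F (Suc n))" "integrable M (\<lambda>\<omega>. (d n \<omega>)\<^sup>2)"
      "AE \<omega> in M. real_cond_exp M (F n) (d n) \<omega> = 0" for n
    using d unfolding martingale_differences_def by simp_all
  have dM: "d n \<in> borel_measurable M" for n
    using dF(1) by (rule measurable_F_M)
  have hM: "h n \<in> borel_measurable M" for n
    using hF by (rule measurable_F_M)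
  have e2: "integrable M (\<lambda>\<omega>. (e n \<omega>)\<^sup>2)" for n
  proof (rule Bochner_Integration.integrable_bound[OF dF(2)[of n]])
    show "(\<lambda>\<omega>. (e n \<omega>)\<^sup>2) \<in> borel_measurable M"
      unfolding e_def by (intro borel_measurable_power borel_measurable_times hM dM)
    show "AE \<omega> in M. norm ((e n \<omega>)\<^sup>2) \<le> norm ((d n \<omega>)\<^sup>2)"
      by (rule AE_I2) (simp add: e_def h01)
  qed
  have e: "martingale_differences e"
    unfolding martingale_differences_def
  proof (intro allI conjI e2)
    fix n
    show "e n \<in> borel_measurable (F (Suc n))"
      unfolding e_def by (rule borel_measurable_times[OF measurable_F_mono[OF hF] dF(1)]) simp
    have "integrable M (\<lambda>\<omega>. (h n \<omega>)\<^sup>2)"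
    proof (rule integrable_const_bound[where B=1])
      show "AE \<omega> in M. norm ((h n \<omega>)\<^sup>2) \<le> 1" by (rule AE_I2) (simp add: h01)
      show "(\<lambda>\<omega>. (h n \<omega>)\<^sup>2) \<in> borel_measurable M" by (rule borel_measurable_power[OF hM])
    qed
    then have "integrable M (\<lambda>\<omega>. h n \<omega> * d n \<omega>)"
      by (rule square_integrable_product[OF hM dM _ dF(2)])
    from sigma_finite_subalgebra.real_cond_exp_mult[OF sigma_finite_subalgebra_F hF dM this]
    show "AE \<omega> in M. real_cond_exp M (F n) (e n) \<omega> = 0"
      using dF(3)[of n] unfolding e_def by eventually_elim simp
  qed
  define U where "U = (\<lambda>\<omega>. \<Sum>i<N. e i \<omega>)"
  \<comment> \<open>if level \<open>c\<close> is reached, then \<open>U\<close> is the partial sum \<open>S m\<close> at the first time \<open>m\<close> it is reached\<close>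
  have stopped: "c \<le> \<bar>U \<omega>\<bar>" if exceeds: "\<exists>n\<le>N. c \<le> \<bar>S n \<omega>\<bar>" for \<omega>
  proof -
    define m where "m = (LEAST n. c \<le> \<bar>S n \<omega>\<bar>)"
    from exceeds obtain n where n: "n \<le> N" "c \<le> \<bar>S n \<omega>\<bar>" by blast
    have m: "c \<le> \<bar>S m \<omega>\<bar>" unfolding m_def by (rule LeastI[of _ n]) (rule n(2))
    have "m \<le> n" unfolding m_def by (rule Least_le) (rule n(2))
    with n(1) have "m \<le> N" by (rule le_trans[rotated])
    have below: "\<bar>S i \<omega>\<bar> < c" if "i < m" for i
      using not_less_Least[of i "\<lambda>n. c \<le> \<bar>S n \<omega>\<bar>"] that unfolding m_def by simp
    have "e i \<omega> = (if i < m then d i \<omega> else 0)" for i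
    proof (cases "i < m")
      case True
      then have "\<forall>j\<le>i. \<bar>S j \<omega>\<bar> < c" using below by simp
      then show ?thesis using True by (simp add: e_def h01)
    next
      case False
      then have "\<not> (\<forall>j\<le>i. \<bar>S j \<omega>\<bar> < c)" using m by (meson not_le)
      then have "h i \<omega> = 0" unfolding h01 by (rule if_not_P)
      then show ?thesis using False by (simp add: e_def)
    qed
    then have "U \<omega> = (\<Sum>i<N. if i < m then d i \<omega> else 0)" by (simp add: U_def)
    also have "\<dots> = S m \<omega>"
      using \<open>m \<le> N\<close> by (auto simp: S_def sum.If_cases intro!: sum.cong)
    finally show ?thesis using m by simp
  qed
  have U2: "integrable M (\<lambda>\<omega>. (U \<omega>)\<^sup>2)"
      "expectation (\<lambda>\<omega>. (U \<omega>)\<^sup>2) = (\<Sum>i<N. expectation (\<lambda>\<omega>. (e i \<omega>)\<^sup>2))"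
    using martingale_square_integral[OF e, of N] by (simp_all add: U_def)
  have U[measurable]: "U \<in> borel_measurable M"
    using measurable_F_M[OF partial_sum_measurable[OF e, of N]] by (simp add: U_def)
  have "prob {\<omega>\<in>space M. \<exists>n\<le>N. c \<le> \<bar>S n \<omega>\<bar>} \<le> prob {\<omega>\<in>space M. c\<^sup>2 \<le> (U \<omega>)\<^sup>2}"
    by (rule finite_measure_mono)
       (use stopped \<open>c > 0\<close> in \<open>auto simp: abs_le_square_iff[symmetric]\<close>)
  also have "\<dots> \<le> expectation (\<lambda>\<omega>. (U \<omega>)\<^sup>2) / c\<^sup>2"
    using \<open>c > 0\<close> by (intro integral_Markov_inequality_measure[where A="{}"]) (use U2 in auto)
  also have "expectation (\<lambda>\<omega>. (U \<omega>)\<^sup>2) = (\<Sum>i<N. expectation (\<lambda>\<omega>. (e i \<omega>)\<^sup>2))" using U2 by simp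
  also have "\<dots> \<le> (\<Sum>i<N. expectation (\<lambda>\<omega>. (d i \<omega>)\<^sup>2))"
    by (intro sum_mono integral_mono e2 dF) (auto simp: e_def h01)
  finally show ?thesis using \<open>c > 0\<close> by (simp add: S_def divide_right_mono)
qed

text \<open>If \<open>\<bar>S\<^sub>N\<bar> \<ge> \<epsilon> N\<close> for some \<open>N\<close> between \<open>2\<^sup>k\<close> and \<open>2\<^sup>k\<^sup>+\<^sup>1\<close>, then the maximum over the block is at least
  \<open>\<epsilon> 2\<^sup>k\<close>. By the maximal inequality and \<open>dyadic_block_summable\<close> these events have summable
  probabilities, so almost surely only finitely many occur.\<close>

lemma martingale_strong_law:
  assumes d: "martingale_differences d"
    and sum: "summable (\<lambda>j. expectation (\<lambda>\<omega>. (d j \<omega>)\<^sup>2) / (real (Suc j))\<^sup>2)"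
  shows "AE \<omega> in M. (\<lambda>N. (\<Sum>i<N. d i \<omega>) / real N) \<longlonglongrightarrow> 0"
proof -
  define S where "S = (\<lambda>n \<omega>. \<Sum>i<n. d i \<omega>)"
  have S[measurable]: "S n \<in> borel_measurable M" for n
    using measurable_F_M[OF partial_sum_measurable[OF d]] by (simp add: S_def)
  have *: "AE \<omega> in M. \<forall>\<^sub>F N in sequentially. \<bar>S N \<omega> / real N\<bar> < \<epsilon>" if "\<epsilon> > 0" for \<epsilon>
  proof -
    define B where "B = (\<lambda>k. {\<omega>\<in>space M. \<exists>n\<le>2 ^ Suc k. \<epsilon> * 2 ^ k \<le> \<bar>S n \<omega>\<bar>})"
    have B[measurable]: "B k \<in> sets M" for k
      unfolding B_def by measurable
    have bound: "prob (B k) \<le> (\<Sum>j<2 ^ Suc k. expectation (\<lambda>\<omega>. (d j \<omega>)\<^sup>2)) / 4 ^ k / \<epsilon>\<^sup>2" for k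
    proof -
      have "(\<epsilon> * 2 ^ k)\<^sup>2 = 4 ^ k * \<epsilon>\<^sup>2"
        by (simp add: power2_eq_square power_mult_distrib[symmetric] mult_ac)
      with martingale_maximal_inequality[OF d, of "\<epsilon> * 2 ^ k" "2 ^ Suc k"] \<open>\<epsilon> > 0\<close>
      show ?thesis by (simp add: B_def S_def)
    qed
    have "summable (\<lambda>k. prob (B k))"
    proof (rule summable_comparison_test')
      show "summable (\<lambda>k. (\<Sum>j<2 ^ Suc k. expectation (\<lambda>\<omega>. (d j \<omega>)\<^sup>2)) / 4 ^ k / \<epsilon>\<^sup>2)"
        by (intro summable_divide dyadic_block_summable sum) simp
      show "norm (prob (B k)) \<le> (\<Sum>j<2 ^ Suc k. expectation (\<lambda>\<omega>. (d j \<omega>)\<^sup>2)) / 4 ^ k / \<epsilon>\<^sup>2"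
        if "k \<ge> 0" for k using bound[of k] by simp
    qed
    from borel_cantelli_AE1[OF B _ this]
    have "AE \<omega> in M. \<forall>\<^sub>F k in sequentially. \<omega> \<in> space M - B k" by (simp add: less_top[symmetric])
    then show ?thesis
    proof eventually_elim
      fix \<omega> assume "\<forall>\<^sub>F k in sequentially. \<omega> \<in> space M - B k"
      then obtain K where K: "\<And>k. k \<ge> K \<Longrightarrow> \<omega> \<in> space M - B k"
        unfolding eventually_sequentially by blast
      show "\<forall>\<^sub>F N in sequentially. \<bar>S N \<omega> / real N\<bar> < \<epsilon>"
        unfolding eventually_sequentially
      proof (intro exI[of _ "2 ^ K"] allI impI)
        fix N :: nat assume "2 ^ K \<le> N"
        then have "N \<ge> 1" by (meson one_le_numeral one_le_power order.trans)
        then obtain k where k: "2 ^ k \<le> N" "N < 2 ^ Suc k"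
          using ex_power_ivl1[of 2 N] unfolding Suc_eq_plus1 by (metis le_refl)
        have "(2::nat) ^ K < 2 ^ Suc k" using \<open>2 ^ K \<le> N\<close> k(2) by (rule le_less_trans)
        then have "K < Suc k" by (rule power_less_imp_less_exp[rotated]) simp
        then have "\<omega> \<in> space M" "\<omega> \<notin> B k" using K[of k] by simp_all
        then have "\<forall>n\<le>2 ^ Suc k. \<not> \<epsilon> * 2 ^ k \<le> \<bar>S n \<omega>\<bar>" unfolding B_def by blast
        then have "\<bar>S N \<omega>\<bar> < \<epsilon> * 2 ^ k"
          using less_imp_le[OF k(2)] not_le by blast
        also have "\<dots> \<le> \<epsilon> * real N"
          using of_nat_mono[OF k(1), where 'a=real] \<open>\<epsilon> > 0\<close> by simp
        finally show "\<bar>S N \<omega> / real N\<bar> < \<epsilon>"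
          using \<open>N \<ge> 1\<close> by (simp add: field_simps)
      qed
    qed
  qed
  have "AE \<omega> in M. \<forall>m. \<forall>\<^sub>F N in sequentially. \<bar>S N \<omega> / real N\<bar> < 1 / real (Suc m)"
    unfolding AE_all_countable by (intro allI *) simp
  then show ?thesis
  proof eventually_elim
    fix \<omega> assume m: "\<forall>m. \<forall>\<^sub>F N in sequentially. \<bar>S N \<omega> / real N\<bar> < 1 / real (Suc m)"
    show "(\<lambda>N. (\<Sum>i<N. d i \<omega>) / real N) \<longlonglongrightarrow> 0"
    proof (rule tendstoI)
      fix e :: real assume "e > 0"
      then obtain m where "1 / real (Suc m) < e" using nat_approx_posE by blast
      with m[rule_format, of m] show "\<forall>\<^sub>F N in sequentially. dist ((\<Sum>i<N. d i \<omega>) / real N) 0 < e"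
        by (auto simp: S_def elim!: eventually_mono)
    qed
  qed
qed

text \<open>The conditional expectation is the projection to the functions of the past, so the residual is no
  larger than the residual of the projection to the constants.\<close>

lemma conditional_centering:
  assumes Y[measurable]: "Y \<in> borel_measurable M" and Y2: "integrable M (\<lambda>\<omega>. (Y \<omega>)\<^sup>2)"
  shows "integrable M (\<lambda>\<omega>. (Y \<omega> - real_cond_exp M (F n) Y \<omega>)\<^sup>2)"
    and "expectation (\<lambda>\<omega>. (Y \<omega> - real_cond_exp M (F n) Y \<omega>)\<^sup>2) \<le> variance Y"
proof -
  interpret sub: sigma_finite_subalgebra M "F n" by (rule sigma_finite_subalgebra_F)
  have Y1: "integrable M Y"
    by (rule square_integrable_imp_integrable[OF Y Y2])
  define m where "m = real_cond_exp M (F n) Y"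
  define c where "c = expectation Y"
  have mF: "m \<in> borel_measurable (F n)" by (simp add: m_def)
  then have [measurable]: "m \<in> borel_measurable M" by (rule measurable_F_M)
  have m2: "integrable M (\<lambda>\<omega>. (m \<omega>)\<^sup>2)"
    unfolding m_def
    by (rule sub.integrable_convex_cond_exp[where I=UNIV and q="\<lambda>x. x\<^sup>2"])
       (use Y1 Y2 convex_power2 emeasure_space_1 in auto)
  have mY: "integrable M (\<lambda>\<omega>. m \<omega> * Y \<omega>)"
    by (rule square_integrable_product) (use m2 Y2 in auto)
  have mYm: "expectation (\<lambda>\<omega>. m \<omega> * Y \<omega>) = expectation (\<lambda>\<omega>. (m \<omega>)\<^sup>2)"
    using sub.real_cond_exp_intg(2)[OF mY mF Y] by (simp add: m_def power2_eq_square)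
  have Em: "expectation m = c" "integrable M m"
    using sub.real_cond_exp_int[OF Y1] by (simp_all add: m_def c_def)
  have eq: "(Y \<omega> - m \<omega>)\<^sup>2 = (Y \<omega>)\<^sup>2 + (m \<omega>)\<^sup>2 - 2 * (m \<omega> * Y \<omega>)" for \<omega>
    by (simp add: power2_diff)
  show "integrable M (\<lambda>\<omega>. (Y \<omega> - real_cond_exp M (F n) Y \<omega>)\<^sup>2)"
    using Y2 m2 mY unfolding m_def[symmetric] eq by simp
  have 1: "expectation (\<lambda>\<omega>. (Y \<omega> - m \<omega>)\<^sup>2) = expectation (\<lambda>\<omega>. (Y \<omega>)\<^sup>2) - expectation (\<lambda>\<omega>. (m \<omega>)\<^sup>2)"
    unfolding eq using Y2 m2 mY mYm by simp
  \<comment> \<open>the variance of the conditional expectation is nonnegative\<close>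
  have "c\<^sup>2 \<le> expectation (\<lambda>\<omega>. (m \<omega>)\<^sup>2)"
    using variance_positive[of m] variance_eq[OF Em(2) m2] unfolding Em(1) by linarith
  moreover have "variance Y = expectation (\<lambda>\<omega>. (Y \<omega>)\<^sup>2) - c\<^sup>2"
    using variance_eq[OF Y1 Y2] by (simp add: c_def)
  ultimately show "expectation (\<lambda>\<omega>. (Y \<omega> - real_cond_exp M (F n) Y \<omega>)\<^sup>2) \<le> variance Y"
    using 1 by (simp add: m_def)
qed

theorem adapted_strong_law:
  assumes Y: "\<And>n. Y n \<in> borel_measurable (F (Suc n))" "\<And>n. integrable M (\<lambda>\<omega>. (Y n \<omega>)\<^sup>2)"
    and sum: "summable (\<lambda>n. variance (Y n) / (real (Suc n))\<^sup>2)"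
  shows "AE \<omega> in M. (\<lambda>N. (\<Sum>n<N. Y n \<omega> - real_cond_exp M (F n) (Y n) \<omega>) / real N) \<longlonglongrightarrow> 0"
proof (rule martingale_strong_law)
  have YM: "Y n \<in> borel_measurable M" for n using Y(1) by (rule measurable_F_M)
  have Y1: "integrable M (Y n)" for n
    by (rule square_integrable_imp_integrable[OF YM Y(2)])
  show "martingale_differences (\<lambda>n \<omega>. Y n \<omega> - real_cond_exp M (F n) (Y n) \<omega>)"
    unfolding martingale_differences_def
  proof (intro allI conjI conditional_centering YM Y)
    fix n
    interpret sub: sigma_finite_subalgebra M "F n" by (rule sigma_finite_subalgebra_F)
    show "(\<lambda>\<omega>. Y n \<omega> - real_cond_exp M (F n) (Y n) \<omega>) \<in> borel_measurable (F (Suc n))"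
      by (rule borel_measurable_diff[OF Y(1) measurable_F_mono[OF borel_measurable_cond_exp]]) simp
    have "AE \<omega> in M. real_cond_exp M (F n) (real_cond_exp M (F n) (Y n)) \<omega> = real_cond_exp M (F n) (Y n) \<omega>"
      using sub.real_cond_exp_int[OF Y1] by (intro sub.real_cond_exp_F_meas) simp_all
    moreover have "AE \<omega> in M. real_cond_exp M (F n) (\<lambda>\<omega>. Y n \<omega> - real_cond_exp M (F n) (Y n) \<omega>) \<omega>
        = real_cond_exp M (F n) (Y n) \<omega> - real_cond_exp M (F n) (real_cond_exp M (F n) (Y n)) \<omega>"
      using sub.real_cond_exp_int[OF Y1] by (intro sub.real_cond_exp_diff Y1)
    ultimately show "AE \<omega> in M. real_cond_exp M (F n) (\<lambda>\<omega>. Y n \<omega> - real_cond_exp M (F n) (Y n) \<omega>) \<omega> = 0"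
      by eventually_elim simp
  qed
  show "summable (\<lambda>n. expectation (\<lambda>\<omega>. (Y n \<omega> - real_cond_exp M (F n) (Y n) \<omega>)\<^sup>2) / (real (Suc n))\<^sup>2)"
  proof (rule summable_comparison_test'[OF sum])
    fix n
    show "norm (expectation (\<lambda>\<omega>. (Y n \<omega> - real_cond_exp M (F n) (Y n) \<omega>)\<^sup>2) / (real (Suc n))\<^sup>2)
        \<le> variance (Y n) / (real (Suc n))\<^sup>2"
      using conditional_centering(2)[OF YM Y(2), of n n] by (simp add: divide_right_mono del: of_nat_Suc)
  qed
qed

end

section \<open>Conditioning on the past of an i.i.d. sequence\<close>

context sequence_space
begin

definition history :: "nat \<Rightarrow> (nat \<Rightarrow> 'a) measure" where
  "history n = vimage_algebra (space S) (\<lambda>\<omega>. restrict \<omega> {..<n}) (\<Pi>\<^sub>M i\<in>{..<n}. M)"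

lemma comb_seq_space: "\<omega> \<in> space S \<Longrightarrow> \<omega>' \<in> space S \<Longrightarrow> comb_seq n \<omega> \<omega>' \<in> space S"
  by (auto simp: space_PiM PiE_iff comb_seq_def)

lemma measurable_restrict_history:
  "(\<lambda>\<omega>. restrict \<omega> {..<n}) \<in> S \<rightarrow>\<^sub>M (\<Pi>\<^sub>M i\<in>{..<n}. M)"
  by (rule measurable_restrict_subset) simp

lemma subalgebra_history: "subalgebra S (history n)"
  unfolding subalgebra_def history_def
  using measurable_sets[OF measurable_restrict_history]
  by (subst sets_vimage_algebra2)
     (auto dest: measurable_space[OF measurable_restrict_history])

text \<open>Membership in the sigma-algebra of the first \<open>n\<close> observations is checked by replacing all later
  ones: a measurable function that does not react equals its value along a path whose continuation
  is that of a fixed path \<open>c\<close>, and that value is a function of the first \<open>n\<close> coordinates.\<close>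

lemma history_measurableI:
  assumes f: "f \<in> S \<rightarrow>\<^sub>M N"
    and dep: "\<And>\<omega> \<omega>'. \<omega> \<in> space S \<Longrightarrow> \<omega>' \<in> space S \<Longrightarrow> f (comb_seq n \<omega> \<omega>') = f \<omega>"
  shows "f \<in> history n \<rightarrow>\<^sub>M N"
proof -
  obtain c where c: "c \<in> space S" using P.not_empty by blast
  have comb: "(\<lambda>r. comb_seq n r c) \<in> (\<Pi>\<^sub>M i\<in>{..<n}. M) \<rightarrow>\<^sub>M S"
  proof (rule measurable_PiM_single')
    fix i
    show "(\<lambda>r. comb_seq n r c i) \<in> (\<Pi>\<^sub>M i\<in>{..<n}. M) \<rightarrow>\<^sub>M M"
    proof (cases "i < n")
      case True
      then show ?thesis by (simp add: comb_seq_def)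
    next
      case False
      then show ?thesis using c by (simp add: comb_seq_def space_PiM PiE_iff)
    qed
  next
    show "(\<lambda>r. comb_seq n r c) \<in> space (\<Pi>\<^sub>M i\<in>{..<n}. M) \<rightarrow> (\<Pi>\<^sub>E i\<in>UNIV. space M)"
      using c by (auto simp: space_PiM PiE_iff comb_seq_def)
  qed
  have "(\<lambda>\<omega>. f (comb_seq n (restrict \<omega> {..<n}) c)) \<in> history n \<rightarrow>\<^sub>M N"
    unfolding history_def
    by (rule measurable_compose[OF measurable_vimage_algebra1 measurable_compose[OF comb f]])
       (use measurable_space[OF measurable_restrict_history] in auto)
  moreover have "comb_seq n (restrict \<omega> {..<n}) c = comb_seq n \<omega> c" for \<omega> :: "nat \<Rightarrow> 'a"
    by (auto simp: comb_seq_def fun_eq_iff)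
  ultimately have "(\<lambda>\<omega>. f (comb_seq n \<omega> c)) \<in> history n \<rightarrow>\<^sub>M N" by simp
  then show ?thesis
    by (rule measurable_cong[THEN iffD1, rotated]) (simp add: dep c history_def)
qed

lemma history_invariant:
  assumes "A \<in> sets (history n)" "n \<le> m" "\<omega> \<in> space S" "\<omega>' \<in> space S"
  shows "comb_seq m \<omega> \<omega>' \<in> A \<longleftrightarrow> \<omega> \<in> A"
proof -
  obtain B where A: "A = (\<lambda>\<omega>. restrict \<omega> {..<n}) -` B \<inter> space S"
    using assms(1) unfolding history_def
    by (subst (asm) sets_vimage_algebra2) (auto dest: measurable_space[OF measurable_restrict_history])
  have "restrict (comb_seq m \<omega> \<omega>') {..<n} = restrict \<omega> {..<n}"
    using \<open>n \<le> m\<close> by (auto simp: comb_seq_def fun_eq_iff)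
  then show ?thesis using comb_seq_space assms(3,4) by (simp add: A)
qed

lemma filtered_history: "filtered_prob_space S history"
proof (intro_locales, rule filtered_prob_space_axioms.intro)
  fix n
  show "subalgebra S (history n)" by (rule subalgebra_history)
  show "subalgebra (history (Suc n)) (history n)"
    unfolding subalgebra_def
  proof (intro conjI subsetI)
    show "space (history n) = space (history (Suc n))" by (simp add: history_def)
    fix A assume A: "A \<in> sets (history n)"
    then have AS: "A \<in> sets S" using subalgebra_history unfolding subalgebra_def by blast
    have "Measurable.pred (history (Suc n)) (\<lambda>\<omega>. \<omega> \<in> A)"
      using history_invariant[OF A, of "Suc n"] AS by (intro history_measurableI) auto
    then have "{\<omega> \<in> space (history (Suc n)). \<omega> \<in> A} \<in> sets (history (Suc n))" by (simp add: pred_def)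
    moreover have "{\<omega> \<in> space (history (Suc n)). \<omega> \<in> A} = A"
      using sets.sets_into_space[OF AS] by (auto simp: history_def)
    ultimately show "A \<in> sets (history (Suc n))" by simp
  qed
qed

sublocale history: filtered_prob_space S history
  by (rule filtered_history)

lemma pair_prob_space_S: "pair_prob_space S S"
  by unfold_locales

lemma AE_comb_seq:
  assumes "AE \<omega> in S. Q \<omega>"
  shows "AE \<omega> in S. AE \<omega>' in S. Q (comb_seq n \<omega> \<omega>')"
proof -
  interpret SS: pair_prob_space S S by (rule pair_prob_space_S)
  have "AE \<omega> in distr (S \<Otimes>\<^sub>M S) S (\<lambda>(\<omega>, \<omega>'). comb_seq n \<omega> \<omega>'). Q \<omega>"
    unfolding PiM_comb_seq by (rule assms)
  then have "AE p in S \<Otimes>\<^sub>M S. Q (case p of (\<omega>, \<omega>') \<Rightarrow> comb_seq n \<omega> \<omega>')"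
    by (rule AE_distrD[OF measurable_comb_seq])
  from SS.AE_pair[OF this] show ?thesis by simp
qed

lemma nn_integral_comb_seq:
  assumes "f \<in> borel_measurable S"
  shows "(\<integral>\<^sup>+\<omega>. f \<omega> \<partial>S) = (\<integral>\<^sup>+\<omega>. \<integral>\<^sup>+\<omega>'. f (comb_seq n \<omega> \<omega>') \<partial>S \<partial>S)"
proof -
  have f: "f \<in> borel_measurable (distr (S \<Otimes>\<^sub>M S) S (\<lambda>(\<omega>, \<omega>'). comb_seq n \<omega> \<omega>'))"
    using assms by simp
  have "(\<integral>\<^sup>+\<omega>. f \<omega> \<partial>S) = (\<integral>\<^sup>+\<omega>. f \<omega> \<partial>distr (S \<Otimes>\<^sub>M S) S (\<lambda>(\<omega>, \<omega>'). comb_seq n \<omega> \<omega>'))"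
    unfolding PiM_comb_seq ..
  also have "\<dots> = (\<integral>\<^sup>+p. f (case p of (\<omega>, \<omega>') \<Rightarrow> comb_seq n \<omega> \<omega>') \<partial>(S \<Otimes>\<^sub>M S))"
    by (rule nn_integral_distr[OF measurable_comb_seq f])
  also have "\<dots> = (\<integral>\<^sup>+\<omega>. \<integral>\<^sup>+\<omega>'. f (comb_seq n \<omega> \<omega>') \<partial>S \<partial>S)"
    using P.nn_integral_fst[OF measurable_compose[OF measurable_comb_seq assms], symmetric] by simp
  finally show ?thesis .
qed

lemma
  fixes f :: "(nat \<Rightarrow> 'a) \<Rightarrow> real"
  assumes "integrable S f"
  shows AE_integrable_comb_seq: "AE \<omega> in S. integrable S (\<lambda>\<omega>'. f (comb_seq n \<omega> \<omega>'))"
    and integrable_comb_seq: "integrable S (\<lambda>\<omega>. \<integral>\<omega>'. f (comb_seq n \<omega> \<omega>') \<partial>S)"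
    and integral_comb_seq: "(\<integral>\<omega>. f \<omega> \<partial>S) = (\<integral>\<omega>. \<integral>\<omega>'. f (comb_seq n \<omega> \<omega>') \<partial>S \<partial>S)"
proof -
  interpret SS: pair_prob_space S S by (rule pair_prob_space_S)
  have "integrable (distr (S \<Otimes>\<^sub>M S) S (\<lambda>(\<omega>, \<omega>'). comb_seq n \<omega> \<omega>')) f"
    unfolding PiM_comb_seq by (rule assms)
  from integrable_distr[OF measurable_comb_seq this]
  have int: "integrable (S \<Otimes>\<^sub>M S) (\<lambda>(\<omega>, \<omega>'). f (comb_seq n \<omega> \<omega>'))" by (simp add: split_beta')
  show "AE \<omega> in S. integrable S (\<lambda>\<omega>'. f (comb_seq n \<omega> \<omega>'))"
    using SS.AE_integrable_fst'[OF int] by simp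
  show "integrable S (\<lambda>\<omega>. \<integral>\<omega>'. f (comb_seq n \<omega> \<omega>') \<partial>S)"
    using SS.integrable_fst'[OF int] by simp
  have "(\<integral>\<omega>. f \<omega> \<partial>S) = (\<integral>\<omega>. f \<omega> \<partial>distr (S \<Otimes>\<^sub>M S) S (\<lambda>(\<omega>, \<omega>'). comb_seq n \<omega> \<omega>'))"
    unfolding PiM_comb_seq ..
  also have "\<dots> = (\<integral>p. f (case p of (\<omega>, \<omega>') \<Rightarrow> comb_seq n \<omega> \<omega>') \<partial>(S \<Otimes>\<^sub>M S))"
    using assms by (intro integral_distr measurable_comb_seq) simp
  also have "\<dots> = (\<integral>\<omega>. \<integral>\<omega>'. f (comb_seq n \<omega> \<omega>') \<partial>S \<partial>S)"
    using SS.integral_fst'[OF int] by (simp add: split_beta')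
  finally show "(\<integral>\<omega>. f \<omega> \<partial>S) = (\<integral>\<omega>. \<integral>\<omega>'. f (comb_seq n \<omega> \<omega>') \<partial>S \<partial>S)" .
qed

text \<open>The law of the sequence is invariant under replacing everything after time \<open>n\<close> by an independent
  copy, and events of the past are not affected by this replacement.\<close>

theorem cond_exp_history:
  assumes h: "integrable S h"
  shows "AE \<omega> in S. real_cond_exp S (history n) h \<omega> = (\<integral>\<omega>'. h (comb_seq n \<omega> \<omega>') \<partial>S)"
proof -
  interpret sub: sigma_finite_subalgebra S "history n" by (rule history.sigma_finite_subalgebra_F)
  have hS[measurable]: "h \<in> borel_measurable S" using h by simp
  show ?thesis
  proof (rule sub.real_cond_exp_charact)
    show "(\<lambda>\<omega>. \<integral>\<omega>'. h (comb_seq n \<omega> \<omega>') \<partial>S) \<in> borel_measurable (history n)"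
    proof (rule history_measurableI)
      show "(\<lambda>\<omega>. \<integral>\<omega>'. h (comb_seq n \<omega> \<omega>') \<partial>S) \<in> borel_measurable S" by measurable
      have "comb_seq n (comb_seq n \<omega> \<omega>') \<omega>'' = comb_seq n \<omega> \<omega>''" for \<omega> \<omega>' \<omega>'' :: "nat \<Rightarrow> 'a"
        by (auto simp: comb_seq_def fun_eq_iff)
      then show "(\<integral>\<omega>''. h (comb_seq n (comb_seq n \<omega> \<omega>') \<omega>'') \<partial>S) = (\<integral>\<omega>''. h (comb_seq n \<omega> \<omega>'') \<partial>S)" for \<omega> \<omega>'
        by simp
    qed
    show "integrable S (\<lambda>\<omega>. \<integral>\<omega>'. h (comb_seq n \<omega> \<omega>') \<partial>S)" by (rule integrable_comb_seq[OF h])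
    fix A assume A: "A \<in> sets (history n)"
    then have AS: "A \<in> sets S" using subalgebra_history unfolding subalgebra_def by blast
    have int: "integrable S (\<lambda>\<omega>. indicator A \<omega> * h \<omega>)"
      using integrable_mult_indicator[OF AS h] by simp
    have "(\<integral>\<omega>. indicator A \<omega> * h \<omega> \<partial>S)
        = (\<integral>\<omega>. \<integral>\<omega>'. indicator A (comb_seq n \<omega> \<omega>') * h (comb_seq n \<omega> \<omega>') \<partial>S \<partial>S)"
      by (rule integral_comb_seq[OF int])
    also have "\<dots> = (\<integral>\<omega>. indicator A \<omega> * (\<integral>\<omega>'. h (comb_seq n \<omega> \<omega>') \<partial>S) \<partial>S)"
    proof (rule Bochner_Integration.integral_cong[OF refl])
      fix \<omega> assume \<omega>: "\<omega> \<in> space S"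
      have "(\<integral>\<omega>'. indicator A (comb_seq n \<omega> \<omega>') * h (comb_seq n \<omega> \<omega>') \<partial>S)
          = (\<integral>\<omega>'. indicator A \<omega> * h (comb_seq n \<omega> \<omega>') \<partial>S)"
        by (rule Bochner_Integration.integral_cong[OF refl])
           (simp add: indicator_def history_invariant[OF A order_refl \<omega>])
      then show "(\<integral>\<omega>'. indicator A (comb_seq n \<omega> \<omega>') * h (comb_seq n \<omega> \<omega>') \<partial>S)
          = indicator A \<omega> * (\<integral>\<omega>'. h (comb_seq n \<omega> \<omega>') \<partial>S)" by simp
    qed
    finally show "(\<integral>\<omega>\<in>A. h \<omega> \<partial>S) = (\<integral>\<omega>\<in>A. (\<integral>\<omega>'. h (comb_seq n \<omega> \<omega>') \<partial>S) \<partial>S)"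
      by (simp add: set_lebesgue_integral_def)
  qed (rule h)
qed

lemma nn_integral_component:
  assumes "f \<in> borel_measurable M"
  shows "(\<integral>\<^sup>+\<omega>. f (\<omega> i) \<partial>S) = (\<integral>\<^sup>+x. f x \<partial>M)"
  using nn_integral_distr[of "\<lambda>\<omega>. \<omega> i" S M f] assms unfolding PiM_component[OF UNIV_I] by simp

lemma integrable_component_iff:
  fixes f :: "'a \<Rightarrow> real"
  assumes "f \<in> borel_measurable M"
  shows "integrable S (\<lambda>\<omega>. f (\<omega> i)) \<longleftrightarrow> integrable M f"
  using integrable_distr_eq[of "\<lambda>\<omega>. \<omega> i" S M f] assms unfolding PiM_component[OF UNIV_I] by simp

lemma integral_component:
  fixes f :: "'a \<Rightarrow> real"
  assumes "f \<in> borel_measurable M"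
  shows "(\<integral>\<omega>. f (\<omega> i) \<partial>S) = (\<integral>x. f x \<partial>M)"
  using integral_distr[of "\<lambda>\<omega>. \<omega> i" S M f] assms unfolding PiM_component[OF UNIV_I] by simp

lemma AE_component_iff:
  assumes "Measurable.pred M Q"
  shows "(AE \<omega> in S. Q (\<omega> i)) \<longleftrightarrow> (AE x in M. Q x)"
  using AE_distr_iff[of "\<lambda>\<omega>. \<omega> i" S M Q] assms unfolding PiM_component[OF UNIV_I] by (simp add: pred_def)

end

section \<open>The strong law of large numbers\<close>

context sequence_space
begin

text \<open>Sum inside the integral: \<open>g x\<close> survives truncation from index \<open>\<bar>g x\<bar> - 1\<close> on, so that the sum is
  \<open>\<bar>g x\<bar>\<^sup>2\<close> times a tail of the inverse squares, hence at most \<open>2 \<bar>g x\<bar>\<close>.\<close>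

lemma truncation_variances_summable:
  assumes g: "integrable M g"
  shows "summable (\<lambda>n. (\<integral>x. (if \<bar>g x\<bar> \<le> real (Suc n) then g x else 0)\<^sup>2 \<partial>M) / (real (Suc n))\<^sup>2)"
proof (rule summableI_nonneg_bounded)
  define z where "z = (\<lambda>n x. if \<bar>g x\<bar> \<le> real (Suc n) then g x else 0)"
  have [measurable]: "g \<in> borel_measurable M" using g by simp
  have z2: "integrable M (\<lambda>x. (z n x)\<^sup>2 / (real (Suc n))\<^sup>2)" for n
  proof (rule M.integrable_const_bound[where B=1])
    show "AE x in M. norm ((z n x)\<^sup>2 / (real (Suc n))\<^sup>2) \<le> 1"
    proof (rule AE_I2)
      fix x
      have "\<bar>z n x\<bar> \<le> \<bar>real (Suc n)\<bar>" by (simp add: z_def)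
      then have "(z n x)\<^sup>2 \<le> (real (Suc n))\<^sup>2" by (simp only: abs_le_square_iff)
      then show "norm ((z n x)\<^sup>2 / (real (Suc n))\<^sup>2) \<le> 1" by (simp del: of_nat_Suc)
    qed
  qed (simp add: z_def)
  fix K
  have "(\<Sum>n<K. (\<integral>x. (z n x)\<^sup>2 \<partial>M) / (real (Suc n))\<^sup>2) = (\<integral>x. (\<Sum>n<K. (z n x)\<^sup>2 / (real (Suc n))\<^sup>2) \<partial>M)"
    using z2 by (simp add: Bochner_Integration.integral_sum)
  also have "\<dots> \<le> (\<integral>x. 2 * \<bar>g x\<bar> \<partial>M)"
  proof (rule integral_mono)
    fix x
    show "(\<Sum>n<K. (z n x)\<^sup>2 / (real (Suc n))\<^sup>2) \<le> 2 * \<bar>g x\<bar>"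
    proof (cases "g x = 0")
      case False
      have "(\<Sum>n<K. (z n x)\<^sup>2 / (real (Suc n))\<^sup>2)
          = \<bar>g x\<bar>\<^sup>2 * (\<Sum>n<K. if \<bar>g x\<bar> \<le> real (Suc n) then 1 / (real (Suc n))\<^sup>2 else 0)"
        unfolding sum_distrib_left by (rule sum.cong) (auto simp: z_def)
      also have "\<dots> \<le> \<bar>g x\<bar>\<^sup>2 * (2 / \<bar>g x\<bar>)"
      proof (intro mult_left_mono order_trans[OF sum_inverse_squares_from])
        show "(if \<bar>g x\<bar> \<le> real K then 2 / \<bar>g x\<bar> - 1 / real K else 0) \<le> 2 / \<bar>g x\<bar>" by simp
      qed (use False in auto)
      also have "\<dots> = 2 * \<bar>g x\<bar>" using False by (auto simp: abs_if power2_eq_square)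
      finally show ?thesis .
    qed (simp add: z_def)
  qed (use g z2 in auto)
  finally show "(\<Sum>n<K. (\<integral>x. (if \<bar>g x\<bar> \<le> real (Suc n) then g x else 0)\<^sup>2 \<partial>M) / (real (Suc n))\<^sup>2) \<le> (\<integral>x. 2 * \<bar>g x\<bar> \<partial>M)"
    by (simp add: z_def)
qed simp

lemma eventually_below_index:
  assumes g: "integrable M g"
  shows "AE \<omega> in S. \<forall>\<^sub>F n in sequentially. \<bar>g (\<omega> n)\<bar> \<le> real (Suc n)"
proof -
  have [measurable]: "g \<in> borel_measurable M" using g by simp
  define A where "A = (\<lambda>n. {\<omega>\<in>space S. real (Suc n) < \<bar>g (\<omega> n)\<bar>})"
  have A: "A n \<in> sets S" for n unfolding A_def by measurable
  have prob: "P.prob (A n) = (\<integral>x. (if real (Suc n) < \<bar>g x\<bar> then 1 else 0) \<partial>M)" for n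
  proof -
    have "P.prob (A n) = (\<integral>\<omega>. indicator (A n) \<omega> \<partial>S)" using A by simp
    also have "\<dots> = (\<integral>\<omega>. (if real (Suc n) < \<bar>g (\<omega> n)\<bar> then 1 else 0) \<partial>S)"
      by (rule Bochner_Integration.integral_cong) (simp_all add: A_def indicator_def)
    also have "\<dots> = (\<integral>x. (if real (Suc n) < \<bar>g x\<bar> then 1 else 0) \<partial>M)"
      by (rule integral_component) measurable
    finally show ?thesis .
  qed
  have int: "integrable M (\<lambda>x. if real (Suc n) < \<bar>g x\<bar> then 1 else (0::real))" for n
    by (rule M.integrable_const_bound[where B=1]) auto
  have "summable (\<lambda>n. P.prob (A n))"
  proof (rule summableI_nonneg_bounded)
    fix K
    have "(\<Sum>n<K. P.prob (A n)) = (\<integral>x. (\<Sum>n<K. if real (Suc n) < \<bar>g x\<bar> then 1 else 0) \<partial>M)"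
      unfolding prob by (rule Bochner_Integration.integral_sum[symmetric]) (rule int)
    also have "\<dots> \<le> (\<integral>x. \<bar>g x\<bar> \<partial>M)"
      using count_below[of "\<bar>g _\<bar>" K] by (intro integral_mono Bochner_Integration.integrable_sum int) (use g in auto)
    finally show "(\<Sum>n<K. P.prob (A n)) \<le> (\<integral>x. \<bar>g x\<bar> \<partial>M)" .
  qed simp
  from borel_cantelli_AE1[OF A _ this]
  have "AE \<omega> in S. \<forall>\<^sub>F n in sequentially. \<omega> \<in> space S - A n" by (simp add: less_top[symmetric])
  then show ?thesis
    by eventually_elim (auto simp: A_def not_less elim!: eventually_mono)
qed

text \<open>Truncate the observation with index \<open>n\<close> at level \<open>n + 1\<close>. Almost surely the truncated sequence differs
  from the original one in finitely many places only; its variances satisfy the condition of the strong law for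
  adapted sequences, and its means converge to the mean of \<open>g\<close>.\<close>

theorem strong_law_of_large_numbers:
  assumes g: "integrable M g"
  shows "AE \<omega> in S. (\<lambda>N. (\<Sum>i<N. g (\<omega> i)) / real N) \<longlonglongrightarrow> (\<integral>x. g x \<partial>M)"
proof -
  have [measurable]: "g \<in> borel_measurable M" using g by simp
  define z where "z = (\<lambda>n x. if \<bar>g x\<bar> \<le> real (Suc n) then g x else 0)"
  have z[measurable]: "z n \<in> borel_measurable M" for n unfolding z_def by measurable
  define Z where "Z = (\<lambda>n \<omega>. z n (\<omega> n))"
  define c where "c = (\<lambda>n. \<integral>x. z n x \<partial>M)"
  have ZS[measurable]: "Z n \<in> borel_measurable S" for n unfolding Z_def by measurable
  have zb: "\<bar>z n x\<bar> \<le> real (Suc n)" for n x by (simp add: z_def)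
  have Z1: "integrable S (Z n)" for n
    by (rule P.integrable_const_bound[where B="real (Suc n)"]) (simp_all add: Z_def zb del: of_nat_Suc)
  have Z2: "integrable S (\<lambda>\<omega>. (Z n \<omega>)\<^sup>2)" for n
  proof (rule P.integrable_const_bound[where B="(real (Suc n))\<^sup>2"])
    show "AE \<omega> in S. norm ((Z n \<omega>)\<^sup>2) \<le> (real (Suc n))\<^sup>2"
    proof (rule AE_I2)
      fix \<omega>
      have "\<bar>Z n \<omega>\<bar> \<le> \<bar>real (Suc n)\<bar>" using zb[of n] by (simp add: Z_def)
      then have "(Z n \<omega>)\<^sup>2 \<le> (real (Suc n))\<^sup>2" by (simp only: abs_le_square_iff)
      then show "norm ((Z n \<omega>)\<^sup>2) \<le> (real (Suc n))\<^sup>2" by simp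
    qed
  qed simp
  have ZF: "Z n \<in> borel_measurable (history (Suc n))" for n
    by (rule history_measurableI) (simp_all add: Z_def comb_seq_def)
  have cond: "AE \<omega> in S. real_cond_exp S (history n) (Z n) \<omega> = c n" for n
  proof -
    have "(\<integral>\<omega>'. Z n (comb_seq n \<omega> \<omega>') \<partial>S) = c n" for \<omega>
      unfolding Z_def c_def by (simp add: comb_seq_def integral_component)
    with cond_exp_history[OF Z1, of n n] show ?thesis by simp
  qed
  have "P.variance (Z n) \<le> (\<integral>x. (z n x)\<^sup>2 \<partial>M)" for n
    using P.variance_eq[OF Z1 Z2, of n] integral_component[of "\<lambda>x. (z n x)\<^sup>2" n] by (simp add: Z_def)
  then have bound: "norm (P.variance (Z n) / (real (Suc n))\<^sup>2) \<le> (\<integral>x. (z n x)\<^sup>2 \<partial>M) / (real (Suc n))\<^sup>2" for n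
    using P.variance_positive[of "Z n"] by (simp add: divide_right_mono del: of_nat_Suc)
  have "summable (\<lambda>n. P.variance (Z n) / (real (Suc n))\<^sup>2)"
    by (rule summable_comparison_test'[OF truncation_variances_summable[OF g, folded z_def[THEN fun_cong, THEN fun_cong]] bound])
  from history.adapted_strong_law[OF ZF Z2 this]
  have 1: "AE \<omega> in S. (\<lambda>N. (\<Sum>n<N. Z n \<omega> - real_cond_exp S (history n) (Z n) \<omega>) / real N) \<longlonglongrightarrow> 0" .
  have "(\<lambda>n. z n x) \<longlonglongrightarrow> g x" for x
  proof (rule tendsto_eventually)
    obtain N where "\<bar>g x\<bar> \<le> real N" using real_arch_simple by blast
    then show "\<forall>\<^sub>F n in sequentially. z n x = g x"
      by (intro eventually_sequentiallyI[of N]) (simp add: z_def)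
  qed
  then have "c \<longlonglongrightarrow> (\<integral>x. g x \<partial>M)"
    unfolding c_def using g
    by (intro integral_dominated_convergence[where w="\<lambda>x. \<bar>g x\<bar>"]) (auto simp: z_def)
  then have 2: "(\<lambda>N. (\<Sum>n<N. c n) / real N) \<longlonglongrightarrow> (\<integral>x. g x \<partial>M)" by (rule Cesaro_mean)
  have "AE \<omega> in S. \<forall>n. real_cond_exp S (history n) (Z n) \<omega> = c n"
    using cond by (simp add: AE_all_countable)
  with 1 eventually_below_index[OF g] show ?thesis
  proof eventually_elim
    fix \<omega>
    assume 1: "(\<lambda>N. (\<Sum>n<N. Z n \<omega> - real_cond_exp S (history n) (Z n) \<omega>) / real N) \<longlonglongrightarrow> 0"
      and c: "\<forall>n. real_cond_exp S (history n) (Z n) \<omega> = c n"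
      and ev: "\<forall>\<^sub>F n in sequentially. \<bar>g (\<omega> n)\<bar> \<le> real (Suc n)"
    have "(\<lambda>n. g (\<omega> n) - Z n \<omega>) \<longlonglongrightarrow> 0"
      by (rule tendsto_eventually) (use ev in \<open>auto simp: Z_def z_def elim!: eventually_mono\<close>)
    from tendsto_add[OF tendsto_add[OF 1 2] Cesaro_mean[OF this]]
    show "(\<lambda>N. (\<Sum>i<N. g (\<omega> i)) / real N) \<longlonglongrightarrow> (\<integral>x. g x \<partial>M)"
      by (simp add: c add_divide_distrib[symmetric] sum.distrib[symmetric])
  qed
qed

end

section \<open>The evidence\<close>

locale bayes_model =
  fixes X :: "'a::euclidean_space set" and f0 :: "'a \<Rightarrow> real" and prior :: "('a \<Rightarrow> real) measure"
  assumes f0_density: "f0 \<in> densities X"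
    and prior: "is_prior X prior"
begin

abbreviation true_law :: "'a measure" where
  "true_law \<equiv> density (base_measure X) (\<lambda>x. ennreal (f0 x))"

lemma space_base[simp]: "space (base_measure X) = X"
  by (simp add: base_measure_def space_restrict_space)

lemma f0_measurable[measurable]: "f0 \<in> borel_measurable (base_measure X)"
  and f0_nonneg: "x \<in> X \<Longrightarrow> 0 \<le> f0 x"
  and f0_integral: "(\<integral>\<^sup>+x. ennreal (f0 x) \<partial>base_measure X) = 1"
  using f0_density by (simp_all add: densities_def)

lemma prob_space_true_law: "prob_space true_law"
proof
  have "emeasure true_law (space (base_measure X))
      = (\<integral>\<^sup>+x. ennreal (f0 x) * indicator (space (base_measure X)) x \<partial>base_measure X)"
    by (rule emeasure_density) (rule measurable_compose[OF f0_measurable measurable_ennreal], rule sets.top)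
  also have "\<dots> = (\<integral>\<^sup>+x. ennreal (f0 x) \<partial>base_measure X)"
    by (rule nn_integral_cong) simp
  finally have "emeasure true_law (space (base_measure X)) = 1" by (simp only: f0_integral)
  then show "emeasure true_law (space true_law) = 1" by simp
qed

sublocale data: sequence_space true_law
  unfolding sequence_space_def by (rule product_prob_spaceI) (rule prob_space_true_law)

sublocale prior: prob_space prior
  using prior by (simp add: is_prior_def)

lemma data_law_eq: "data_law X f0 = data.S"
  by (simp add: data_law_def)

lemma prior_density: "f \<in> space prior \<Longrightarrow> f \<in> densities X"
  using prior by (auto simp: is_prior_def)

lemma prior_nonneg: "f \<in> space prior \<Longrightarrow> x \<in> X \<Longrightarrow> 0 \<le> f x"
  using prior_density by (auto simp: densities_def)

lemma path_in_X: "\<omega> \<in> space data.S \<Longrightarrow> \<omega> i \<in> X"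
  by (simp add: space_PiM PiE_iff)

lemma AE_f0_pos: "AE x in true_law. 0 < f0 x"
  by (subst AE_density) auto

lemma evaluation_measurable:
  assumes "F \<in> N \<rightarrow>\<^sub>M prior" "G \<in> N \<rightarrow>\<^sub>M base_measure X"
  shows "(\<lambda>z. F z (G z)) \<in> borel_measurable N"
  using measurable_compose[OF measurable_Pair[OF assms], of "\<lambda>(f, x). f x" borel] prior
  by (simp add: is_prior_def)

lemma likelihood_ratio_measurable:
  assumes [measurable]: "F \<in> N \<rightarrow>\<^sub>M prior" "W \<in> N \<rightarrow>\<^sub>M data.S"
  shows "(\<lambda>z. likelihood_ratio f0 (W z) n (F z)) \<in> borel_measurable N"
proof -
  have [measurable]: "(\<lambda>z. W z i) \<in> N \<rightarrow>\<^sub>M base_measure X" for i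
    using measurable_compose[OF assms(2) measurable_component_singleton[of i UNIV "\<lambda>_. true_law"]] by simp
  have [measurable]: "(\<lambda>z. F z (W z i)) \<in> borel_measurable N" for i
    by (rule evaluation_measurable) measurable
  show ?thesis unfolding likelihood_ratio_def by measurable
qed

lemma likelihood_ratio_nonneg:
  "f \<in> space prior \<Longrightarrow> \<omega> \<in> space data.S \<Longrightarrow> 0 \<le> likelihood_ratio f0 \<omega> n f"
  unfolding likelihood_ratio_def
  by (intro prod_nonneg divide_nonneg_nonneg ballI) (auto intro: prior_nonneg f0_nonneg path_in_X)

lemma likelihood_ratio_comb_seq:
  "likelihood_ratio f0 (comb_seq n \<omega> \<omega>') n f = likelihood_ratio f0 \<omega> n f"
  "likelihood_ratio f0 (comb_seq n \<omega> \<omega>') (Suc n) f = likelihood_ratio f0 \<omega> n f * (f (\<omega>' 0) / f0 (\<omega>' 0))"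
  by (simp_all add: likelihood_ratio_def comb_seq_def)

lemma evidence_comb_seq: "evidence prior f0 (comb_seq n \<omega> \<omega>') n = evidence prior f0 \<omega> n"
  by (simp add: evidence_def likelihood_ratio_comb_seq)

lemma evidence_measurable[measurable]: "(\<lambda>\<omega>. evidence prior f0 \<omega> n) \<in> borel_measurable data.S"
proof -
  have "(\<lambda>(\<omega>, f). likelihood_ratio f0 \<omega> n f) \<in> borel_measurable (data.S \<Otimes>\<^sub>M prior)"
    unfolding split_beta' by (rule likelihood_ratio_measurable) measurable
  then show ?thesis unfolding evidence_def by measurable
qed

lemma evidence_nonneg: "\<omega> \<in> space data.S \<Longrightarrow> 0 \<le> evidence prior f0 \<omega> n"
  unfolding evidence_def by (rule integral_nonneg_AE) (auto intro: likelihood_ratio_nonneg)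

text \<open>The Bochner integral \<open>evidence\<close> is \<open>0\<close> when the likelihood ratio is not integrable. This version is
  \<open>\<infinity>\<close> then, so Tonelli's theorem applies to it without any integrability.\<close>

definition nn_evidence :: "(nat \<Rightarrow> 'a) \<Rightarrow> nat \<Rightarrow> ennreal" where
  "nn_evidence \<omega> n = (\<integral>\<^sup>+f. ennreal (likelihood_ratio f0 \<omega> n f) \<partial>prior)"

lemma nn_evidence_measurable[measurable]: "(\<lambda>\<omega>. nn_evidence \<omega> n) \<in> borel_measurable data.S"
proof -
  have [measurable]: "(\<lambda>(\<omega>, f). likelihood_ratio f0 \<omega> n f) \<in> borel_measurable (data.S \<Otimes>\<^sub>M prior)"
    unfolding split_beta' by (rule likelihood_ratio_measurable) measurable
  show ?thesis unfolding nn_evidence_def by measurable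
qed

lemma likelihood_ratio_measurable_prior:
  "\<omega> \<in> space data.S \<Longrightarrow> likelihood_ratio f0 \<omega> n \<in> borel_measurable prior"
  using likelihood_ratio_measurable[of "\<lambda>f. f" prior "\<lambda>_. \<omega>" n] by simp

lemma nn_evidence_eq:
  assumes \<omega>: "\<omega> \<in> space data.S" and finite: "nn_evidence \<omega> n < \<infinity>"
  shows "nn_evidence \<omega> n = ennreal (evidence prior f0 \<omega> n)"
proof -
  have int: "integrable prior (likelihood_ratio f0 \<omega> n)"
    using finite likelihood_ratio_nonneg[OF _ \<omega>] unfolding nn_evidence_def
    by (intro integrableI_nonneg likelihood_ratio_measurable_prior \<omega>) auto
  show "nn_evidence \<omega> n = ennreal (evidence prior f0 \<omega> n)"
    unfolding nn_evidence_def evidence_def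
    by (rule nn_integral_eq_integral[OF int]) (auto intro: likelihood_ratio_nonneg \<omega>)
qed

text \<open>The inequality may be strict, since \<open>f\<close> can have mass where \<open>f0\<close> vanishes.\<close>

lemma nn_integral_density_ratio_le_1:
  assumes "f \<in> densities X"
  shows "(\<integral>\<^sup>+x. ennreal (f x / f0 x) \<partial>true_law) \<le> 1"
proof -
  have [measurable]: "f \<in> borel_measurable (base_measure X)" using assms by (simp add: densities_def)
  have "(\<integral>\<^sup>+x. ennreal (f x / f0 x) \<partial>true_law) = (\<integral>\<^sup>+x. ennreal (f0 x) * ennreal (f x / f0 x) \<partial>base_measure X)"
    by (rule nn_integral_density) measurable
  also have "\<dots> \<le> (\<integral>\<^sup>+x. ennreal (f x) \<partial>base_measure X)"
  proof (rule nn_integral_mono)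
    fix x assume "x \<in> space (base_measure X)"
    then have "0 \<le> f x" "0 \<le> f0 x" using assms f0_nonneg by (simp_all add: densities_def)
    then show "ennreal (f0 x) * ennreal (f x / f0 x) \<le> ennreal (f x)"
      by (simp add: ennreal_mult[symmetric])
  qed
  also have "\<dots> = 1" using assms by (simp add: densities_def)
  finally show ?thesis .
qed

text \<open>Exchange the integrals over the prior and over the next observation. For each density the new
  factor of the likelihood ratio has mean at most \<open>1\<close>.\<close>

lemma nn_evidence_supermartingale:
  assumes \<omega>: "\<omega> \<in> space data.S"
  shows "(\<integral>\<^sup>+\<omega>'. nn_evidence (comb_seq n \<omega> \<omega>') (Suc n) \<partial>data.S) \<le> nn_evidence \<omega> n"
proof -
  interpret pair: pair_sigma_finite prior data.S ..
  let ?L = "likelihood_ratio f0 \<omega> n"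
  note [measurable] = likelihood_ratio_measurable_prior[OF \<omega>]
  have ratio[measurable]: "(\<lambda>p. fst p (snd p 0)) \<in> borel_measurable (prior \<Otimes>\<^sub>M data.S)"
    "f \<in> space prior \<Longrightarrow> f \<in> borel_measurable (base_measure X)"
    for f
  proof -
    have "(\<lambda>p. snd p 0) \<in> (prior \<Otimes>\<^sub>M data.S) \<rightarrow>\<^sub>M true_law" by measurable
    then have "(\<lambda>p. snd p 0) \<in> (prior \<Otimes>\<^sub>M data.S) \<rightarrow>\<^sub>M base_measure X" by simp
    then show "(\<lambda>p. fst p (snd p 0)) \<in> borel_measurable (prior \<Otimes>\<^sub>M data.S)"
      by (intro evaluation_measurable) measurable
    show "f \<in> borel_measurable (base_measure X)" if "f \<in> space prior"
      using prior_density[OF that] by (simp add: densities_def)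
  qed
  have [measurable]: "(\<lambda>p. f0 (snd p 0)) \<in> borel_measurable (prior \<Otimes>\<^sub>M data.S)" by measurable
  have "(\<integral>\<^sup>+\<omega>'. nn_evidence (comb_seq n \<omega> \<omega>') (Suc n) \<partial>data.S)
      = (\<integral>\<^sup>+\<omega>'. \<integral>\<^sup>+f. ennreal (?L f * (f (\<omega>' 0) / f0 (\<omega>' 0))) \<partial>prior \<partial>data.S)"
    by (simp add: nn_evidence_def likelihood_ratio_comb_seq)
  also have "\<dots> = (\<integral>\<^sup>+f. \<integral>\<^sup>+\<omega>'. ennreal (?L f * (f (\<omega>' 0) / f0 (\<omega>' 0))) \<partial>data.S \<partial>prior)"
    by (rule pair.Fubini') (simp add: split_beta')
  also have "\<dots> \<le> (\<integral>\<^sup>+f. ennreal (?L f) \<partial>prior)"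
  proof (rule nn_integral_mono)
    fix f assume f: "f \<in> space prior"
    note [measurable] = ratio(2)[OF f]
    have "(\<integral>\<^sup>+\<omega>'. ennreal (?L f * (f (\<omega>' 0) / f0 (\<omega>' 0))) \<partial>data.S)
        = (\<integral>\<^sup>+\<omega>'. ennreal (?L f) * ennreal (f (\<omega>' 0) / f0 (\<omega>' 0)) \<partial>data.S)"
      by (subst ennreal_mult'[OF likelihood_ratio_nonneg[OF f \<omega>]]) (rule refl)
    also have "\<dots> = ennreal (?L f) * (\<integral>\<^sup>+\<omega>'. ennreal (f (\<omega>' 0) / f0 (\<omega>' 0)) \<partial>data.S)"
      by (rule nn_integral_cmult) measurable
    also have "(\<integral>\<^sup>+\<omega>'. ennreal (f (\<omega>' 0) / f0 (\<omega>' 0)) \<partial>data.S) = (\<integral>\<^sup>+x. ennreal (f x / f0 x) \<partial>true_law)"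
      by (rule data.nn_integral_component) measurable
    also have "ennreal (?L f) * \<dots> \<le> ennreal (?L f) * 1"
      by (intro mult_left_mono nn_integral_density_ratio_le_1 prior_density f) simp
    finally show "(\<integral>\<^sup>+\<omega>'. ennreal (?L f * (f (\<omega>' 0) / f0 (\<omega>' 0))) \<partial>data.S) \<le> ennreal (?L f)" by simp
  qed
  finally show ?thesis by (simp add: nn_evidence_def)
qed

lemma nn_evidence_integral_le_1: "(\<integral>\<^sup>+\<omega>. nn_evidence \<omega> n \<partial>data.S) \<le> 1"
proof (induction n)
  case 0
  then show ?case
    by (simp add: nn_evidence_def likelihood_ratio_def prior.emeasure_space_1 data.P.emeasure_space_1)
next
  case (Suc n)
  have "(\<integral>\<^sup>+\<omega>. nn_evidence \<omega> (Suc n) \<partial>data.S)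
      = (\<integral>\<^sup>+\<omega>. \<integral>\<^sup>+\<omega>'. nn_evidence (comb_seq n \<omega> \<omega>') (Suc n) \<partial>data.S \<partial>data.S)"
    by (rule data.nn_integral_comb_seq) measurable
  also have "\<dots> \<le> (\<integral>\<^sup>+\<omega>. nn_evidence \<omega> n \<partial>data.S)"
    by (intro nn_integral_mono nn_evidence_supermartingale)
  finally show ?case using Suc.IH by simp
qed

lemma AE_nn_evidence_finite: "AE \<omega> in data.S. \<forall>n. nn_evidence \<omega> n < \<infinity>"
  unfolding AE_all_countable
proof
  fix n
  have "(\<integral>\<^sup>+\<omega>. nn_evidence \<omega> n \<partial>data.S) \<noteq> \<infinity>"
    using nn_evidence_integral_le_1[of n] by (auto simp: top_unique)
  then have "AE \<omega> in data.S. nn_evidence \<omega> n \<noteq> \<infinity>"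
    by (intro nn_integral_PInf_AE) measurable
  then show "AE \<omega> in data.S. nn_evidence \<omega> n < \<infinity>"
    by eventually_elim (simp add: less_top)
qed

section \<open>Integral form of the divergence\<close>

lemma KL_integrand_measurable:
  assumes [measurable]: "p \<in> borel_measurable (base_measure X)"
  shows "KL_integrand p f0 \<in> borel_measurable (base_measure X)"
  unfolding KL_integrand_def by measurable

text \<open>Passing from Lebesgue measure to the true law absorbs the factor \<open>f0\<close> of the integrand and ignores
  the points where \<open>f0\<close> vanishes, at which the integrand is \<open>0\<close> by convention.\<close>

lemma
  assumes p[measurable]: "p \<in> borel_measurable (base_measure X)" and pos: "AE x in true_law. 0 < p x"
  shows KL_positive_part: "(\<integral>\<^sup>+x. e2ennreal (KL_integrand p f0 x) \<partial>base_measure X)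
      = (\<integral>\<^sup>+x. ennreal (- ln (p x / f0 x)) \<partial>true_law)"
    and KL_negative_part: "(\<integral>\<^sup>+x. e2ennreal (- KL_integrand p f0 x) \<partial>base_measure X)
      = (\<integral>\<^sup>+x. ennreal (ln (p x / f0 x)) \<partial>true_law)"
proof -
  have "AE x in base_measure X. 0 < f0 x \<longrightarrow> 0 < p x"
    using pos by (subst (asm) AE_density) auto
  then have eq: "AE x in base_measure X. KL_integrand p f0 x = ereal (f0 x * - ln (p x / f0 x))"
    using AE_space
  proof eventually_elim
    fix x assume "0 < f0 x \<longrightarrow> 0 < p x" "x \<in> space (base_measure X)"
    then show "KL_integrand p f0 x = ereal (f0 x * - ln (p x / f0 x))"
      using f0_nonneg[of x] by (cases "f0 x = 0") (auto simp: KL_integrand_def ln_div algebra_simps)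
  qed
  have f0: "AE x in base_measure X. 0 \<le> f0 x"
    using AE_space by eventually_elim (simp add: f0_nonneg)
  show "(\<integral>\<^sup>+x. e2ennreal (KL_integrand p f0 x) \<partial>base_measure X)
      = (\<integral>\<^sup>+x. ennreal (- ln (p x / f0 x)) \<partial>true_law)"
    by (subst nn_integral_density, measurable, rule nn_integral_cong_AE)
       (use eq f0 in eventually_elim, simp add: ennreal_mult'[symmetric])
  show "(\<integral>\<^sup>+x. e2ennreal (- KL_integrand p f0 x) \<partial>base_measure X)
      = (\<integral>\<^sup>+x. ennreal (ln (p x / f0 x)) \<partial>true_law)"
    by (subst nn_integral_density, measurable, rule nn_integral_cong_AE)
       (use eq f0 in eventually_elim, simp add: ennreal_mult'[symmetric])
qed

lemma KL_eq_integral: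
  assumes p[measurable]: "p \<in> borel_measurable (base_measure X)" and pos: "AE x in true_law. 0 < p x"
    and int: "integrable true_law (\<lambda>x. ln (p x / f0 x))"
  shows "KL X p f0 = ereal (- (\<integral>x. ln (p x / f0 x) \<partial>true_law))"
proof -
  define a where "a = enn2real (\<integral>\<^sup>+x. ennreal (- ln (p x / f0 x)) \<partial>true_law)"
  define b where "b = enn2real (\<integral>\<^sup>+x. ennreal (ln (p x / f0 x)) \<partial>true_law)"
  have a: "(\<integral>\<^sup>+x. ennreal (- ln (p x / f0 x)) \<partial>true_law) = ennreal a"
    and b: "(\<integral>\<^sup>+x. ennreal (ln (p x / f0 x)) \<partial>true_law) = ennreal b"
    using int unfolding real_integrable_def a_def b_def by (simp_all add: less_top)
  have "(\<integral>x. ln (p x / f0 x) \<partial>true_law) = b - a"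
    unfolding a_def b_def by (rule real_lebesgue_integral_def[OF int])
  moreover have "0 \<le> a" "0 \<le> b" by (simp_all add: a_def b_def)
  ultimately show ?thesis
    unfolding KL_def KL_positive_part[OF p pos] KL_negative_part[OF p pos] a b by simp
qed

text \<open>The part of \<open>f0 ln (f0 / f)\<close> below zero is bounded by \<open>f\<close>, because \<open>ln t \<le> t\<close>; its integral is
  therefore at most \<open>1\<close>. A divergence below \<open>\<epsilon>\<close> then leaves at most \<open>\<epsilon> + 1\<close> for the positive part.
  The resulting bound on the absolute logarithm does not depend on \<open>f\<close>, which makes it integrable
  over any set of such densities.\<close>

lemma
  assumes f: "f \<in> densities X" and KL: "KL X f f0 < ereal \<epsilon>"
  shows KL_finite_pos: "AE x in true_law. 0 < f x"
    and KL_finite_abs_bound: "(\<integral>\<^sup>+x. ennreal \<bar>ln (f x / f0 x)\<bar> \<partial>true_law) \<le> ennreal (\<epsilon> + 2)"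
    and KL_finite_integral: "- \<epsilon> \<le> (\<integral>x. ln (f x / f0 x) \<partial>true_law)"
proof -
  have [measurable]: "f \<in> borel_measurable (base_measure X)" using f by (simp add: densities_def)
  have fnn: "0 \<le> f x" if "x \<in> X" for x using f that by (simp add: densities_def)
  define A where "A = (\<integral>\<^sup>+x. e2ennreal (KL_integrand f f0 x) \<partial>base_measure X)"
  define B where "B = (\<integral>\<^sup>+x. e2ennreal (- KL_integrand f f0 x) \<partial>base_measure X)"
  have "B \<le> (\<integral>\<^sup>+x. ennreal (f x) \<partial>base_measure X)"
    unfolding B_def
  proof (rule nn_integral_mono)
    fix x assume "x \<in> space (base_measure X)"
    then have nn: "0 \<le> f x" "0 \<le> f0 x" using fnn f0_nonneg by simp_all
    show "e2ennreal (- KL_integrand f f0 x) \<le> ennreal (f x)"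
    proof (cases "f0 x = 0 \<or> f x = 0")
      case True
      then show ?thesis by (auto simp: KL_integrand_def e2ennreal_neg)
    next
      case False
      then have pos: "0 < f x" "0 < f0 x" using nn by auto
      have "ln (f x / f0 x) \<le> f x / f0 x - 1"
        using pos by (intro ln_le_minus_one) simp
      then have "f0 x * ln (f x / f0 x) \<le> f0 x * (f x / f0 x - 1)"
        using pos by (intro mult_left_mono) auto
      also have "\<dots> \<le> f x" using pos by (simp add: field_simps)
      finally have "- (f0 x * ln (f0 x / f x)) \<le> f x"
        using pos by (simp add: ln_div algebra_simps)
      then show ?thesis using pos by (simp add: KL_integrand_def ennreal_leI)
    qed
  qed
  then have B1: "B \<le> 1" using f by (simp add: densities_def)
  then obtain b where b: "B = ennreal b" "0 \<le> b" by (cases B) (auto simp: top_unique)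
  with B1 have "b \<le> 1" by simp
  have KL': "enn2ereal A - enn2ereal B < ereal \<epsilon>" using KL by (simp add: KL_def A_def B_def)
  then obtain a where a: "A = ennreal a" "0 \<le> a" using b by (cases A) auto
  have ab: "a - b < \<epsilon>" using KL' a b by simp
  have "AE x in base_measure X. e2ennreal (KL_integrand f f0 x) \<noteq> \<infinity>"
    using a KL_integrand_measurable[of f] unfolding A_def by (intro nn_integral_PInf_AE) auto
  then have "AE x in base_measure X. 0 < f0 x \<longrightarrow> 0 < f x"
    using AE_space
  proof eventually_elim
    fix x assume *: "e2ennreal (KL_integrand f f0 x) \<noteq> \<infinity>" "x \<in> space (base_measure X)"
    show "0 < f0 x \<longrightarrow> 0 < f x"
      using * fnn[of x] by (cases "f x = 0") (auto simp: KL_integrand_def)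
  qed
  then show pos: "AE x in true_law. 0 < f x" by (subst AE_density) auto
  have A': "(\<integral>\<^sup>+x. ennreal (- ln (f x / f0 x)) \<partial>true_law) = ennreal a"
    using KL_positive_part[OF _ pos] a by (simp add: A_def)
  have B': "(\<integral>\<^sup>+x. ennreal (ln (f x / f0 x)) \<partial>true_law) = ennreal b"
    using KL_negative_part[OF _ pos] b by (simp add: B_def)
  have "(\<integral>\<^sup>+x. ennreal \<bar>ln (f x / f0 x)\<bar> \<partial>true_law)
      = (\<integral>\<^sup>+x. ennreal (- ln (f x / f0 x)) + ennreal (ln (f x / f0 x)) \<partial>true_law)"
    by (rule nn_integral_cong) (auto simp: abs_if ennreal_neg)
  also have "\<dots> = ennreal a + ennreal b"
    unfolding A'[symmetric] B'[symmetric] by (rule nn_integral_add) measurable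
  also have "\<dots> \<le> ennreal (\<epsilon> + 2)"
    using a b ab \<open>b \<le> 1\<close> by (simp add: ennreal_plus[symmetric] ennreal_leI del: ennreal_plus)
  finally show "(\<integral>\<^sup>+x. ennreal \<bar>ln (f x / f0 x)\<bar> \<partial>true_law) \<le> ennreal (\<epsilon> + 2)" .
  have int: "integrable true_law (\<lambda>x. ln (f x / f0 x))"
    unfolding real_integrable_def A' B' by simp
  show "- \<epsilon> \<le> (\<integral>x. ln (f x / f0 x) \<partial>true_law)"
    using KL KL_eq_integral[OF _ pos int] by simp
qed

section \<open>Lower bound for the evidence\<close>

text \<open>The function \<open>g\<close> is the average of \<open>ln (f / f0)\<close> over the prior \<open>Q\<close> conditioned on the set \<open>A\<close> of
  densities with divergence below \<open>\<epsilon>\<close>, and \<open>a\<close> is the prior mass of \<open>A\<close>. Restricting the evidence to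
  \<open>A\<close> costs the factor \<open>a\<close>; Jensen's inequality moves the exponential out of the average over \<open>Q\<close>.\<close>

lemma evidence_lower_bound:
  assumes KL: "KL_property X f0 prior" and "\<epsilon> > 0"
  obtains a g where "a > 0" "integrable true_law g" "- \<epsilon> \<le> (\<integral>x. g x \<partial>true_law)"
    "AE \<omega> in data.S. \<forall>n. a * exp (\<Sum>i<n. g (\<omega> i)) \<le> evidence prior f0 \<omega> n"
proof -
  define A where "A = {f \<in> space prior. KL X f f0 < ereal \<epsilon>}"
  define a where "a = measure prior A"
  have a: "a > 0" using assms by (simp add: KL_property_def a_def A_def)
  then have A: "A \<in> sets prior" using measure_notin_sets unfolding a_def by fastforce
  have eA: "emeasure prior A = ennreal a" by (simp add: a_def prior.emeasure_eq_measure)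
  define Q where "Q = uniform_measure prior A"
  have sets_Q[measurable_cong]: "sets Q = sets prior" by (simp add: Q_def)
  interpret Q: prob_space Q
    unfolding Q_def by (rule prob_space_uniform_measure) (use eA a in auto)
  interpret pair: pair_sigma_finite Q true_law ..
  have AE_Q: "AE f in Q. f \<in> A" unfolding Q_def by (rule AE_uniform_measureI[OF A]) simp
  have AD: "f \<in> densities X" "KL X f f0 < ereal \<epsilon>" if "f \<in> A" for f
    using that prior_density by (auto simp: A_def)
  define l where "l = (\<lambda>f x. ln (f x / f0 x))"
  have ev[measurable]: "(\<lambda>p. fst p (snd p)) \<in> borel_measurable (Q \<Otimes>\<^sub>M true_law)"
  proof (rule evaluation_measurable)
    show "fst \<in> Q \<Otimes>\<^sub>M true_law \<rightarrow>\<^sub>M prior"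
      using measurable_fst[of Q true_law] by (simp add: measurable_cong_sets[OF refl sets_Q])
    show "snd \<in> Q \<Otimes>\<^sub>M true_law \<rightarrow>\<^sub>M base_measure X"
      using measurable_snd[of Q true_law] by simp
  qed
  have f0_snd[measurable]: "(\<lambda>p. f0 (snd p)) \<in> borel_measurable (Q \<Otimes>\<^sub>M true_law)"
    by (rule measurable_compose[OF measurable_snd]) simp
  have l_meas[measurable]: "case_prod l \<in> borel_measurable (Q \<Otimes>\<^sub>M true_law)"
    unfolding l_def split_beta' by measurable
  have "(\<integral>\<^sup>+p. ennreal (norm (case_prod l p)) \<partial>(Q \<Otimes>\<^sub>M true_law))
      = (\<integral>\<^sup>+f. \<integral>\<^sup>+x. ennreal \<bar>l f x\<bar> \<partial>true_law \<partial>Q)"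
    by (subst data.M.nn_integral_fst[symmetric]) (auto simp: split_beta')
  also have "\<dots> \<le> (\<integral>\<^sup>+f. ennreal (\<epsilon> + 2) \<partial>Q)"
    by (rule nn_integral_mono_AE)
       (use AE_Q in \<open>eventually_elim, simp add: l_def KL_finite_abs_bound[OF AD]\<close>)
  also have "\<dots> < \<infinity>" by (simp add: Q.emeasure_space_1)
  finally have int: "integrable (Q \<Otimes>\<^sub>M true_law) (case_prod l)"
    unfolding integrable_iff_bounded using l_meas by blast
  define g where "g = (\<lambda>x. \<integral>f. l f x \<partial>Q)"
  have g_int: "integrable true_law g"
    unfolding g_def by (rule pair.integrable_snd[OF int])
  have "- \<epsilon> \<le> (\<integral>f. \<integral>x. l f x \<partial>true_law \<partial>Q)"
    by (rule Q.integral_ge_const[OF pair.integrable_fst[OF int]])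
       (use AE_Q in \<open>eventually_elim, simp add: l_def KL_finite_integral[OF AD]\<close>)
  also have "\<dots> = (\<integral>x. g x \<partial>true_law)"
    unfolding g_def by (rule pair.Fubini_integral[OF int, symmetric])
  finally have g_ge: "- \<epsilon> \<le> (\<integral>x. g x \<partial>true_law)" .
  have "AE f in Q. AE x in true_law. 0 < f x"
    using AE_Q by eventually_elim (rule KL_finite_pos[OF AD])
  then have "AE x in true_law. AE f in Q. 0 < f x"
    by (subst (asm) pair.AE_commute) (use ev in measurable)
  then have good: "AE x in true_law. integrable Q (\<lambda>f. l f x) \<and> 0 < f0 x \<and> (AE f in Q. 0 < f x)"
    using pair.AE_integrable_snd[OF int] AE_f0_pos by eventually_elim simp
  have "AE \<omega> in data.S. \<forall>i. integrable Q (\<lambda>f. l f (\<omega> i)) \<and> 0 < f0 (\<omega> i) \<and> (AE f in Q. 0 < f (\<omega> i))"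
    unfolding AE_all_countable by (intro allI data.AE_component UNIV_I good)
  then have "AE \<omega> in data.S. \<forall>n. a * exp (\<Sum>i<n. g (\<omega> i)) \<le> evidence prior f0 \<omega> n"
    using AE_nn_evidence_finite AE_space
  proof eventually_elim
    fix \<omega>
    assume good: "\<forall>i. integrable Q (\<lambda>f. l f (\<omega> i)) \<and> 0 < f0 (\<omega> i) \<and> (AE f in Q. 0 < f (\<omega> i))"
      and finite: "\<forall>n. nn_evidence \<omega> n < \<infinity>" and \<omega>: "\<omega> \<in> space data.S"
    show "\<forall>n. a * exp (\<Sum>i<n. g (\<omega> i)) \<le> evidence prior f0 \<omega> n"
    proof
      fix n
      let ?L = "likelihood_ratio f0 \<omega> n"
      define s where "s = (\<lambda>f. \<Sum>i<n. l f (\<omega> i))"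
      define m where "m = (\<Sum>i<n. g (\<omega> i))"
      have s_int: "integrable Q s" unfolding s_def using good by auto
      have m: "(\<integral>f. s f \<partial>Q) = m"
        unfolding s_def m_def g_def using good by (intro Bochner_Integration.integral_sum) auto
      have "AE f in Q. \<forall>i. 0 < f (\<omega> i)" using good by (simp add: AE_all_countable)
      \<comment> \<open>Jensen's inequality, as integration of the tangent of the exponential function at \<open>m\<close>\<close>
      then have tangent: "AE f in Q. exp m * (1 + (s f - m)) \<le> ?L f"
      proof eventually_elim
        fix f :: "'a \<Rightarrow> real" assume pos: "\<forall>i. 0 < f (\<omega> i)"
        have "exp m * (1 + (s f - m)) \<le> exp m * exp (s f - m)"
          by (intro mult_left_mono exp_ge_add_one_self) simp
        also have "\<dots> = exp (s f)" by (simp add: exp_add[symmetric])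
        also have "\<dots> = ?L f"
          using pos good by (simp add: s_def l_def likelihood_ratio_def exp_sum)
        finally show "exp m * (1 + (s f - m)) \<le> ?L f" .
      qed
      have L_meas: "?L \<in> borel_measurable Q"
        using likelihood_ratio_measurable_prior[OF \<omega>] by (simp add: measurable_cong_sets[OF sets_Q refl])
      have L_nn: "AE f in Q. 0 \<le> ?L f"
        using AE_Q by eventually_elim (auto simp: A_def intro: likelihood_ratio_nonneg \<omega>)
      have LQ: "(\<integral>\<^sup>+f. ennreal (?L f) \<partial>Q) \<le> nn_evidence \<omega> n / ennreal a"
      proof -
        have "(\<integral>\<^sup>+f. ennreal (?L f) \<partial>Q) = (\<integral>\<^sup>+f. ennreal (?L f) * indicator A f \<partial>prior) / ennreal a"
          unfolding Q_def eA[symmetric]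
          using likelihood_ratio_measurable_prior[OF \<omega>] A by (intro nn_integral_uniform_measure) auto
        also have "\<dots> \<le> nn_evidence \<omega> n / ennreal a"
          unfolding nn_evidence_def
          by (intro divide_right_mono_ennreal nn_integral_mono) (simp add: indicator_def)
        finally show ?thesis .
      qed
      have e: "nn_evidence \<omega> n / ennreal a = ennreal (evidence prior f0 \<omega> n / a)"
        using nn_evidence_eq[OF \<omega>] finite a by (simp add: divide_ennreal evidence_nonneg[OF \<omega>])
      have L_int: "integrable Q ?L"
        by (rule integrableI_nonneg[OF L_meas L_nn]) (rule le_less_trans[OF LQ], simp add: e)
      have "exp m = (\<integral>f. exp m * (1 + (s f - m)) \<partial>Q)"
        using s_int m Q.prob_space by simp
      also have "\<dots> \<le> (\<integral>f. ?L f \<partial>Q)"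
        using s_int L_int tangent by (intro integral_mono_AE) auto
      finally have "ennreal (exp m) \<le> ennreal (\<integral>f. ?L f \<partial>Q)" by (rule ennreal_leI)
      also have "\<dots> = (\<integral>\<^sup>+f. ennreal (?L f) \<partial>Q)"
        by (rule nn_integral_eq_integral[OF L_int L_nn, symmetric])
      also have "\<dots> \<le> ennreal (evidence prior f0 \<omega> n / a)" using LQ unfolding e .
      finally have "exp m \<le> evidence prior f0 \<omega> n / a"
        using evidence_nonneg[OF \<omega>, of n] a by (subst (asm) ennreal_le_iff) simp_all
      then show "a * exp (\<Sum>i<n. g (\<omega> i)) \<le> evidence prior f0 \<omega> n"
        using a by (simp add: m_def field_simps)
    qed
  qed
  with a g_int g_ge show ?thesis by (rule that)
qed

lemma AE_evidence_pos:
  assumes "KL_property X f0 prior"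
  shows "AE \<omega> in data.S. \<forall>n. 0 < evidence prior f0 \<omega> n"
proof -
  obtain a g where a: "a > 0" and "integrable true_law g" "- 1 \<le> (\<integral>x. g x \<partial>true_law)"
    and lower: "AE \<omega> in data.S. \<forall>n. a * exp (\<Sum>i<n. g (\<omega> i)) \<le> evidence prior f0 \<omega> n"
    by (rule evidence_lower_bound[OF assms zero_less_one])
  from lower show ?thesis
  proof eventually_elim
    fix \<omega> assume lower: "\<forall>n. a * exp (\<Sum>i<n. g (\<omega> i)) \<le> evidence prior f0 \<omega> n"
    have "0 < a * exp (\<Sum>i<n. g (\<omega> i))" for n using a by simp
    then show "\<forall>n. 0 < evidence prior f0 \<omega> n" using lower less_le_trans by blast
  qed
qed

section \<open>Divergence of the predictive density\<close>

definition log_increment :: "nat \<Rightarrow> (nat \<Rightarrow> 'a) \<Rightarrow> real" where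
  "log_increment n \<omega> = ln (evidence prior f0 \<omega> (Suc n) / evidence prior f0 \<omega> n)"

lemma predictive_eq:
  assumes \<omega>: "\<omega> \<in> space data.S" and x: "x \<in> X"
  shows "predictive prior f0 \<omega> n x
    = (\<integral>f. likelihood_ratio f0 \<omega> n f / evidence prior f0 \<omega> n * f x \<partial>prior)"
proof -
  have "(\<lambda>f. f x) \<in> borel_measurable prior"
    using x by (intro evaluation_measurable) auto
  then have "predictive prior f0 \<omega> n x
      = (\<integral>f. (likelihood_ratio f0 \<omega> n f / evidence prior f0 \<omega> n) *\<^sub>R f x \<partial>prior)"
    unfolding predictive_def posterior_def
  proof (rule integral_density)
    show "(\<lambda>f. likelihood_ratio f0 \<omega> n f / evidence prior f0 \<omega> n) \<in> borel_measurable prior"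
      using likelihood_ratio_measurable_prior[OF \<omega>] by simp
    show "AE f in prior. 0 \<le> likelihood_ratio f0 \<omega> n f / evidence prior f0 \<omega> n"
      by (rule AE_I2) (simp add: likelihood_ratio_nonneg \<omega> evidence_nonneg)
  qed
  then show ?thesis by simp
qed

lemma predictive_measurable:
  assumes \<omega>: "\<omega> \<in> space data.S"
  shows "predictive prior f0 \<omega> n \<in> borel_measurable (base_measure X)"
proof -
  have "(\<lambda>p. likelihood_ratio f0 \<omega> n (snd p)) \<in> borel_measurable (base_measure X \<Otimes>\<^sub>M prior)"
    by (rule measurable_compose[OF measurable_snd likelihood_ratio_measurable_prior[OF \<omega>]])
  moreover have "(\<lambda>p. (snd p) (fst p)) \<in> borel_measurable (base_measure X \<Otimes>\<^sub>M prior)"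
    by (rule evaluation_measurable) measurable
  ultimately have "(\<lambda>(x, f). likelihood_ratio f0 \<omega> n f / evidence prior f0 \<omega> n * f x)
      \<in> borel_measurable (base_measure X \<Otimes>\<^sub>M prior)"
    unfolding split_beta' by measurable
  then have "(\<lambda>x. \<integral>f. likelihood_ratio f0 \<omega> n f / evidence prior f0 \<omega> n * f x \<partial>prior)
      \<in> borel_measurable (base_measure X)" by measurable
  then show ?thesis
    by (rule measurable_cong[THEN iffD1, rotated]) (simp add: predictive_eq[OF \<omega>])
qed

text \<open>The path \<open>comb_seq n \<omega> \<omega>'\<close> has \<open>\<omega>' 0\<close> as the observation after the first \<open>n\<close> observations of \<open>\<omega>\<close>.\<close>

lemma evidence_ratio_eq_predictive:
  assumes "\<omega> \<in> space data.S" "\<omega>' \<in> space data.S"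
  shows "evidence prior f0 (comb_seq n \<omega> \<omega>') (Suc n) / evidence prior f0 (comb_seq n \<omega> \<omega>') n
    = predictive prior f0 \<omega> n (\<omega>' 0) / f0 (\<omega>' 0)"
proof -
  have "evidence prior f0 (comb_seq n \<omega> \<omega>') (Suc n) / evidence prior f0 \<omega> n
      = (\<integral>f. likelihood_ratio f0 \<omega> n f * (f (\<omega>' 0) / f0 (\<omega>' 0)) / evidence prior f0 \<omega> n \<partial>prior)"
    by (simp add: evidence_def likelihood_ratio_comb_seq)
  also have "\<dots> = (\<integral>f. likelihood_ratio f0 \<omega> n f / evidence prior f0 \<omega> n * f (\<omega>' 0) / f0 (\<omega>' 0) \<partial>prior)"
    by (simp add: field_simps)
  also have "\<dots> = predictive prior f0 \<omega> n (\<omega>' 0) / f0 (\<omega>' 0)"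
    using assms by (simp add: predictive_eq path_in_X)
  finally show ?thesis by (simp add: evidence_comb_seq)
qed

text \<open>By \<open>evidence_ratio_eq_predictive\<close> the conditional mean of the log increment is the integral of
  \<open>ln (predictive / f0)\<close> against the true law, which is minus the divergence. It is at most \<open>0\<close>
  because \<open>ln t \<le> t - 1\<close> and the evidence is a supermartingale. Integrability of the log increment
  ensures that for almost every past the divergence is finite.\<close>

lemma KL_predictive:
  assumes pos: "AE \<omega> in data.S. \<forall>n. 0 < evidence prior f0 \<omega> n"
    and int: "integrable data.S (log_increment n)"
  shows "AE \<omega> in data.S. KL X (predictive prior f0 \<omega> n) f0
        = ereal (- (\<integral>\<omega>'. log_increment n (comb_seq n \<omega> \<omega>') \<partial>data.S))
      \<and> (\<integral>\<omega>'. log_increment n (comb_seq n \<omega> \<omega>') \<partial>data.S) \<le> 0"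
  using pos data.AE_comb_seq[OF pos, of n] AE_nn_evidence_finite
    data.AE_integrable_comb_seq[OF int, of n] AE_space
proof eventually_elim
  fix \<omega>
  let ?p = "predictive prior f0 \<omega> n" and ?I = "evidence prior f0 \<omega> n"
  let ?I' = "\<lambda>\<omega>'. evidence prior f0 (comb_seq n \<omega> \<omega>') (Suc n)"
  assume I: "\<forall>n. 0 < evidence prior f0 \<omega> n"
    and I': "AE \<omega>' in data.S. \<forall>m. 0 < evidence prior f0 (comb_seq n \<omega> \<omega>') m"
    and finite: "\<forall>n. nn_evidence \<omega> n < \<infinity>"
    and int: "integrable data.S (\<lambda>\<omega>'. log_increment n (comb_seq n \<omega> \<omega>'))"
    and \<omega>: "\<omega> \<in> space data.S"
  note [measurable] = predictive_measurable[OF \<omega>, of n]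
  have eq: "log_increment n (comb_seq n \<omega> \<omega>') = ln (?p (\<omega>' 0) / f0 (\<omega>' 0))" if "\<omega>' \<in> space data.S" for \<omega>'
    unfolding log_increment_def using evidence_ratio_eq_predictive[OF \<omega> that] by simp
  have int': "integrable true_law (\<lambda>x. ln (?p x / f0 x))"
    using int eq by (subst data.integrable_component_iff[symmetric, where i=0])
      (auto cong: Bochner_Integration.integrable_cong)
  have eqI: "(\<integral>\<omega>'. log_increment n (comb_seq n \<omega> \<omega>') \<partial>data.S) = (\<integral>x. ln (?p x / f0 x) \<partial>true_law)"
    by (subst data.integral_component[symmetric, where i=0])
       (auto simp: eq cong: Bochner_Integration.integral_cong)
  have "AE \<omega>' in data.S. 0 < f0 (\<omega>' 0)" by (intro data.AE_component UNIV_I AE_f0_pos)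
  with I' AE_space have "AE \<omega>' in data.S. 0 < ?p (\<omega>' 0)"
  proof eventually_elim
    fix \<omega>' assume *: "\<forall>m. 0 < evidence prior f0 (comb_seq n \<omega> \<omega>') m" "\<omega>' \<in> space data.S" "0 < f0 (\<omega>' 0)"
    then have "0 < ?p (\<omega>' 0) / f0 (\<omega>' 0)"
      using evidence_ratio_eq_predictive[OF \<omega> *(2), of n] by (metis divide_pos_pos)
    with *(3) show "0 < ?p (\<omega>' 0)" by (simp add: zero_less_divide_iff)
  qed
  then have p_pos: "AE x in true_law. 0 < ?p x"
    by (subst (asm) data.AE_component_iff) auto
  have "(\<integral>\<^sup>+\<omega>'. ennreal (?I' \<omega>') \<partial>data.S) \<le> (\<integral>\<^sup>+\<omega>'. nn_evidence (comb_seq n \<omega> \<omega>') (Suc n) \<partial>data.S)"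
  proof (rule nn_integral_mono)
    fix \<omega>' assume "\<omega>' \<in> space data.S"
    then have "comb_seq n \<omega> \<omega>' \<in> space data.S" by (rule data.comb_seq_space[OF \<omega>])
    then show "ennreal (?I' \<omega>') \<le> nn_evidence (comb_seq n \<omega> \<omega>') (Suc n)"
      using nn_evidence_eq[of "comb_seq n \<omega> \<omega>'" "Suc n"]
      by (cases "nn_evidence (comb_seq n \<omega> \<omega>') (Suc n) < \<infinity>") (auto simp: less_top[symmetric])
  qed
  also have "\<dots> \<le> ennreal ?I"
    using nn_evidence_supermartingale[OF \<omega>, of n] nn_evidence_eq[OF \<omega>, of n] finite by simp
  finally have le: "(\<integral>\<^sup>+\<omega>'. ennreal (?I' \<omega>') \<partial>data.S) \<le> ennreal ?I" .
  have comb_meas: "comb_seq n \<omega> \<in> data.S \<rightarrow>\<^sub>M data.S" using \<omega> by measurable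
  have I'_nn: "AE \<omega>' in data.S. 0 \<le> ?I' \<omega>'"
    by (rule AE_I2) (intro evidence_nonneg data.comb_seq_space \<omega>)
  have I'_int: "integrable data.S ?I'"
    by (rule integrableI_nonneg[OF measurable_compose[OF comb_meas evidence_measurable] I'_nn])
       (use le in \<open>auto intro: le_less_trans\<close>)
  have "ennreal (\<integral>\<omega>'. ?I' \<omega>' \<partial>data.S) \<le> ennreal ?I"
    using le nn_integral_eq_integral[OF I'_int I'_nn] by simp
  then have mean: "(\<integral>\<omega>'. ?I' \<omega>' \<partial>data.S) \<le> ?I"
    using evidence_nonneg[OF \<omega>, of n] by (simp add: ennreal_le_iff)
  have "(\<integral>\<omega>'. log_increment n (comb_seq n \<omega> \<omega>') \<partial>data.S) \<le> (\<integral>\<omega>'. ?I' \<omega>' / ?I - 1 \<partial>data.S)"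
  proof (rule integral_mono_AE[OF int])
    show "integrable data.S (\<lambda>\<omega>'. ?I' \<omega>' / ?I - 1)" using I'_int by simp
    show "AE \<omega>' in data.S. log_increment n (comb_seq n \<omega> \<omega>') \<le> ?I' \<omega>' / ?I - 1"
      using I'
    proof eventually_elim
      fix \<omega>' assume "\<forall>m. 0 < evidence prior f0 (comb_seq n \<omega> \<omega>') m"
      then show "log_increment n (comb_seq n \<omega> \<omega>') \<le> ?I' \<omega>' / ?I - 1"
        unfolding log_increment_def evidence_comb_seq using I by (intro ln_le_minus_one) simp
    qed
  qed
  also have "\<dots> = (\<integral>\<omega>'. ?I' \<omega>' \<partial>data.S) / ?I - 1"
    using I'_int data.P.prob_space by simp
  also have "\<dots> \<le> 0" using mean I by simp
  finally show "KL X ?p f0 = ereal (- (\<integral>\<omega>'. log_increment n (comb_seq n \<omega> \<omega>') \<partial>data.S))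
      \<and> (\<integral>\<omega>'. log_increment n (comb_seq n \<omega> \<omega>') \<partial>data.S) \<le> 0"
    unfolding eqI using KL_eq_integral[OF _ p_pos int'] by simp
qed

section \<open>Averages of the divergence\<close>

lemma log_increment_measurable_history: "log_increment n \<in> borel_measurable (data.history (Suc n))"
proof (rule data.history_measurableI)
  show "log_increment n \<in> borel_measurable data.S"
    unfolding log_increment_def by measurable
  fix \<omega> \<omega>'
  have "likelihood_ratio f0 (comb_seq (Suc n) \<omega> \<omega>') n = likelihood_ratio f0 \<omega> n"
    by (simp add: likelihood_ratio_def comb_seq_def fun_eq_iff)
  then show "log_increment n (comb_seq (Suc n) \<omega> \<omega>') = log_increment n \<omega>"
    unfolding log_increment_def evidence_comb_seq by (simp add: evidence_def)
qed

lemma evidence_0: "evidence prior f0 \<omega> 0 = 1"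
  by (simp add: evidence_def likelihood_ratio_def prior.prob_space)

lemma sum_log_increment:
  assumes "\<forall>n. 0 < evidence prior f0 \<omega> n"
  shows "(\<Sum>n<N. log_increment n \<omega>) = ln (evidence prior f0 \<omega> N)"
proof (induction N)
  case (Suc N)
  have "log_increment N \<omega> = ln (evidence prior f0 \<omega> (Suc N)) - ln (evidence prior f0 \<omega> N)"
    unfolding log_increment_def using assms by (intro ln_divide_pos) auto
  then show ?case using Suc.IH by simp
qed (simp add: evidence_0)

text \<open>The average of the divergences is the average of the centered log increments, which tends to \<open>0\<close>,
  minus \<open>ln I\<^sub>N / N\<close>. By \<open>evidence_lower_bound\<close>, the latter is eventually above every number less than
  \<open>-\<epsilon>\<close>, so the average of the divergences is eventually below \<open>2 \<epsilon>\<close>.\<close>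

theorem predictive_KL_average_tendsto_0:
  assumes KLp: "KL_property X f0 prior"
    and sq: "\<And>n. integrable data.S (\<lambda>\<omega>. (log_increment n \<omega>)\<^sup>2)"
    and var: "summable (\<lambda>n. data.P.variance (log_increment n) / (real (Suc n))\<^sup>2)"
  shows "AE \<omega> in data.S. (\<lambda>N. (\<Sum>n<N. KL X (predictive prior f0 \<omega> n) f0) / ereal (real N)) \<longlonglongrightarrow> 0"
proof -
  let ?D = "\<lambda>\<omega> n. - (\<integral>\<omega>'. log_increment n (comb_seq n \<omega> \<omega>') \<partial>data.S)"
  have meas: "log_increment n \<in> borel_measurable data.S" for n
    using log_increment_measurable_history by (rule data.history.measurable_F_M)
  have int: "integrable data.S (log_increment n)" for n
    by (rule data.P.square_integrable_imp_integrable[OF meas sq])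
  note pos = AE_evidence_pos[OF KLp]
  have D: "AE \<omega> in data.S. \<forall>n. KL X (predictive prior f0 \<omega> n) f0 = ereal (?D \<omega> n) \<and> 0 \<le> ?D \<omega> n"
    using KL_predictive[OF pos int] unfolding AE_all_countable by simp
  have cond: "AE \<omega> in data.S. \<forall>n. real_cond_exp data.S (data.history n) (log_increment n) \<omega> = - ?D \<omega> n"
    using data.cond_exp_history[OF int] unfolding AE_all_countable by simp
  have centered: "AE \<omega> in data.S. (\<lambda>N. (\<Sum>n<N. log_increment n \<omega>
      - real_cond_exp data.S (data.history n) (log_increment n) \<omega>) / real N) \<longlonglongrightarrow> 0"
    by (rule data.history.adapted_strong_law[OF log_increment_measurable_history sq var])
  have upper: "AE \<omega> in data.S. \<forall>\<^sub>F N in sequentially. (\<Sum>n<N. ?D \<omega> n) / real N < 2 * \<epsilon>" if "\<epsilon> > 0" for \<epsilon>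
  proof -
    obtain a g where a: "a > 0" and g: "integrable true_law g" "- \<epsilon> \<le> (\<integral>x. g x \<partial>true_law)"
      and lower: "AE \<omega> in data.S. \<forall>n. a * exp (\<Sum>i<n. g (\<omega> i)) \<le> evidence prior f0 \<omega> n"
      using evidence_lower_bound[OF KLp \<open>\<epsilon> > 0\<close>] .
    show ?thesis
      using centered cond lower pos data.strong_law_of_large_numbers[OF g(1)]
    proof eventually_elim
      fix \<omega>
      assume centered: "(\<lambda>N. (\<Sum>n<N. log_increment n \<omega>
            - real_cond_exp data.S (data.history n) (log_increment n) \<omega>) / real N) \<longlonglongrightarrow> 0"
        and cond: "\<forall>n. real_cond_exp data.S (data.history n) (log_increment n) \<omega> = - ?D \<omega> n"
        and lower: "\<forall>n. a * exp (\<Sum>i<n. g (\<omega> i)) \<le> evidence prior f0 \<omega> n"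
        and pos: "\<forall>n. 0 < evidence prior f0 \<omega> n"
        and slln: "(\<lambda>N. (\<Sum>i<N. g (\<omega> i)) / real N) \<longlonglongrightarrow> (\<integral>x. g x \<partial>true_law)"
      define T where "T = (\<lambda>N. (\<Sum>n<N. log_increment n \<omega>
            - real_cond_exp data.S (data.history n) (log_increment n) \<omega>) / real N)"
      have T: "T N = (ln (evidence prior f0 \<omega> N) + (\<Sum>n<N. ?D \<omega> n)) / real N" for N
        using sum_log_increment[OF pos, of N] cond unfolding T_def by (simp add: sum_subtractf sum_negf)
      have bound: "(\<Sum>n<N. ?D \<omega> n) / real N \<le> T N - ln a / real N - (\<Sum>i<N. g (\<omega> i)) / real N" for N
      proof -
        have "ln (a * exp (\<Sum>i<N. g (\<omega> i))) \<le> ln (evidence prior f0 \<omega> N)"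
          using lower pos a by (subst ln_le_cancel_iff) auto
        then have "ln a + (\<Sum>i<N. g (\<omega> i)) \<le> ln (evidence prior f0 \<omega> N)"
          using a by (simp add: ln_mult)
        then have "(\<Sum>n<N. ?D \<omega> n) / real N
            \<le> (ln (evidence prior f0 \<omega> N) + (\<Sum>n<N. ?D \<omega> n) - ln a - (\<Sum>i<N. g (\<omega> i))) / real N"
          by (intro divide_right_mono) auto
        then show ?thesis unfolding T by (simp add: diff_divide_distrib)
      qed
      have "(\<lambda>N. T N - ln a / real N - (\<Sum>i<N. g (\<omega> i)) / real N) \<longlonglongrightarrow> 0 - 0 - (\<integral>x. g x \<partial>true_law)"
        using centered unfolding T_def[symmetric]
        by (intro tendsto_diff slln lim_const_over_n)
      moreover have "0 - 0 - (\<integral>x. g x \<partial>true_law) < 2 * \<epsilon>" using g(2) \<open>\<epsilon> > 0\<close> by linarith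
      ultimately have "\<forall>\<^sub>F N in sequentially. T N - ln a / real N - (\<Sum>i<N. g (\<omega> i)) / real N < 2 * \<epsilon>"
        by (rule order_tendstoD(2))
      then show "\<forall>\<^sub>F N in sequentially. (\<Sum>n<N. ?D \<omega> n) / real N < 2 * \<epsilon>"
        by eventually_elim (rule le_less_trans[OF bound])
    qed
  qed
  have "AE \<omega> in data.S. \<forall>m. \<forall>\<^sub>F N in sequentially. (\<Sum>n<N. ?D \<omega> n) / real N < 2 * (1 / real (Suc m))"
    unfolding AE_all_countable by (intro allI upper) simp
  with D show ?thesis
  proof eventually_elim
    fix \<omega>
    assume D: "\<forall>n. KL X (predictive prior f0 \<omega> n) f0 = ereal (?D \<omega> n) \<and> 0 \<le> ?D \<omega> n"
      and upper: "\<forall>m. \<forall>\<^sub>F N in sequentially. (\<Sum>n<N. ?D \<omega> n) / real N < 2 * (1 / real (Suc m))"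
    have nonneg: "0 \<le> (\<Sum>n<N. ?D \<omega> n) / real N" for N
      using D by (intro divide_nonneg_nonneg sum_nonneg) auto
    have "(\<lambda>N. (\<Sum>n<N. ?D \<omega> n) / real N) \<longlonglongrightarrow> 0"
    proof (rule tendstoI)
      fix e :: real assume "e > 0"
      then obtain m where m: "1 / real (Suc m) < e / 2" using nat_approx_posE[of "e / 2"] by auto
      from upper have "\<forall>\<^sub>F N in sequentially. (\<Sum>n<N. ?D \<omega> n) / real N < 2 * (1 / real (Suc m))" ..
      then show "\<forall>\<^sub>F N in sequentially. dist ((\<Sum>n<N. ?D \<omega> n) / real N) 0 < e"
      proof eventually_elim
        fix N assume "(\<Sum>n<N. ?D \<omega> n) / real N < 2 * (1 / real (Suc m))"
        with m have "(\<Sum>n<N. ?D \<omega> n) / real N < e" by linarith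
        with nonneg[of N] show "dist ((\<Sum>n<N. ?D \<omega> n) / real N) 0 < e"
          unfolding dist_real_def by linarith
      qed
    qed
    then have "(\<lambda>N. ereal ((\<Sum>n<N. ?D \<omega> n) / real N)) \<longlonglongrightarrow> ereal 0" by (rule tendsto_ereal)
    then show "(\<lambda>N. (\<Sum>n<N. KL X (predictive prior f0 \<omega> n) f0) / ereal (real N)) \<longlonglongrightarrow> 0"
      unfolding zero_ereal_def
    proof (rule Lim_transform_eventually)
      show "\<forall>\<^sub>F N in sequentially. ereal ((\<Sum>n<N. ?D \<omega> n) / real N)
          = (\<Sum>n<N. KL X (predictive prior f0 \<omega> n) f0) / ereal (real N)"
        using eventually_gt_at_top[of 0]
      proof eventually_elim
        fix N :: nat assume "0 < N"
        have "(\<Sum>n<N. KL X (predictive prior f0 \<omega> n) f0) = ereal (\<Sum>n<N. ?D \<omega> n)"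
          using D by simp
        then show "ereal ((\<Sum>n<N. ?D \<omega> n) / real N)
          = (\<Sum>n<N. KL X (predictive prior f0 \<omega> n) f0) / ereal (real N)"
          using \<open>0 < N\<close> by simp
      qed
    qed
  qed
qed

end

lemma ext_variance_finite:
  assumes "prob_space M" and finite: "ext_variance M Y < \<infinity>"
  shows "integrable M (\<lambda>\<omega>. (Y \<omega>)\<^sup>2)"
    and "ext_variance M Y = ennreal (\<integral>\<omega>. (Y \<omega> - (\<integral>\<omega>'. Y \<omega>' \<partial>M))\<^sup>2 \<partial>M)"
proof -
  interpret prob_space M by fact
  define c where "c = expectation Y"
  have Y: "integrable M Y" using finite by (auto simp: ext_variance_def split: if_splits)
  have ext: "ext_variance M Y = (\<integral>\<^sup>+\<omega>. ennreal ((Y \<omega> - c)\<^sup>2) \<partial>M)"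
    using Y by (simp add: ext_variance_def c_def)
  have int: "integrable M (\<lambda>\<omega>. (Y \<omega> - c)\<^sup>2)"
    using Y finite unfolding ext by (intro integrableI_nonneg) auto
  show "ext_variance M Y = ennreal (\<integral>\<omega>. (Y \<omega> - (\<integral>\<omega>'. Y \<omega>' \<partial>M))\<^sup>2 \<partial>M)"
    unfolding ext c_def[symmetric] by (rule nn_integral_eq_integral[OF int]) simp
  have "integrable M (\<lambda>\<omega>. (Y \<omega> - c)\<^sup>2 + 2 * c * Y \<omega> - c\<^sup>2)" using int Y by simp
  moreover have "(Y \<omega> - c)\<^sup>2 + 2 * c * Y \<omega> - c\<^sup>2 = (Y \<omega>)\<^sup>2" for \<omega>
    by (simp add: power2_diff)
  ultimately show "integrable M (\<lambda>\<omega>. (Y \<omega>)\<^sup>2)" by simp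
qed

theorem theorem3:
  fixes X :: "'a::euclidean_space set"
    and f0 :: "'a \<Rightarrow> real"
    and prior :: "('a \<Rightarrow> real) measure"
  assumes "X \<in> sets borel"
    and "f0 \<in> densities X"
    and "is_prior X prior"
    and "KL_property X f0 prior"
    and "(\<Sum>k. let n = Suc k in
            ext_variance (data_law X f0) (\<lambda>\<omega>. ln (evidence prior f0 \<omega> n / evidence prior f0 \<omega> (n - 1))) / ennreal (real n ^ 2)) < \<infinity>"
  shows "AE \<omega> in data_law X f0.
    (\<lambda>N::nat. (\<Sum>n=1..N. KL X (predictive prior f0 \<omega> (n - 1)) f0) / ereal (real N)) \<longlonglongrightarrow> 0"
proof -
  interpret bayes_model X f0 prior using assms(2,3) by unfold_locales
  let ?V = "\<lambda>n. ext_variance data.S (log_increment n)"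
  have sum: "(\<Sum>n. ?V n / ennreal ((real (Suc n))\<^sup>2)) < \<infinity>"
    using assms(5) by (simp add: log_increment_def[abs_def] data_law_eq Let_def)
  have "?V n < \<infinity>" for n
  proof (rule ccontr)
    assume "\<not> ?V n < \<infinity>"
    then have top: "?V n / ennreal ((real (Suc n))\<^sup>2) = \<infinity>"
      by (simp add: less_top[symmetric] ennreal_top_divide)
    have "?V n / ennreal ((real (Suc n))\<^sup>2) \<le> (\<Sum>n. ?V n / ennreal ((real (Suc n))\<^sup>2))"
      using sum_le_suminf[OF summableI, of "{n}" "\<lambda>n. ?V n / ennreal ((real (Suc n))\<^sup>2)"] by simp
    from le_less_trans[OF this sum] show False unfolding top by simp
  qed
  note V = ext_variance_finite[OF data.P.prob_space_axioms this]
  have "(\<Sum>n. ennreal (data.P.variance (log_increment n) / (real (Suc n))\<^sup>2)) < \<infinity>"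
    using sum unfolding V(2) by (subst (asm) divide_ennreal) simp_all
  then have "summable (\<lambda>n. data.P.variance (log_increment n) / (real (Suc n))\<^sup>2)"
    by (intro summable_suminf_not_top) auto
  from predictive_KL_average_tendsto_0[OF assms(4) V(1) this]
  show ?thesis
    unfolding data_law_eq by (simp add: sum.atLeast1_atMost_eq)
qed

end
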